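(* Let $0<p<1$ be fixed, let $G=B(n,p)$ be the random simple graph on $n$ vertices, and let $N(n)$ be the number of groupies in $G$. Then for every $\epsilon>0$, $$P\left(\left|\frac{N(n)}{n}-\Phi(1)\right|>\epsilon\right)\longrightarrow 0\quad\text{as } n\to\infty,$$ where $\Phi$ is the cumulative distribution function of the standard normal distribution $N(0,1)$.
   Context: $B(n,p)$ denotes the random simple graph on $n$ labelled vertices in which each of the $\binom n2$ possible edges is present independently with probability $p$. Groupie: let $G=(V,E)$ be a simple graph with $|V|=n$ and $|E|=e$. For $v\in V$ let $r(v)$ be the sum of the degrees of the neighbors of $v$. A non-isolated vertex $v$ is a groupie if the average degree of its neighbors is not less than the average degree of all vertices of $G$, i.e. $\frac{r(v)}{\deg(v)}\ge\frac{2e}{n}$. An isolated vertex $v$ is a groupie if and only if all vertices of $G$ are isolated. *)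

theory Defs
  imports "HOL-Probability.Probability"
begin

text \<open>A simple graph is given by its vertex set \<open>V\<close> and its edge set
  \<open>E \<subseteq> all_edges V\<close>, an edge being the two-element set of its endpoints.\<close>

definition all_edges :: "'a set \<Rightarrow> 'a set set" where
  "all_edges V = {e. e \<subseteq> V \<and> card e = 2}"

definition neighbors :: "'a set \<Rightarrow> 'a set set \<Rightarrow> 'a \<Rightarrow> 'a set" where
  "neighbors V E v = {u \<in> V. {v, u} \<in> E}"

definition degree :: "'a set \<Rightarrow> 'a set set \<Rightarrow> 'a \<Rightarrow> nat" where
  "degree V E v = card (neighbors V E v)"

definition neighbor_degree_sum :: "'a set \<Rightarrow> 'a set set \<Rightarrow> 'a \<Rightarrow> nat" where
  "neighbor_degree_sum V E v = (\<Sum>u\<in>neighbors V E v. degree V E u)"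

definition groupie :: "'a set \<Rightarrow> 'a set set \<Rightarrow> 'a \<Rightarrow> bool" where
  "groupie V E v \<longleftrightarrow>
    (if degree V E v = 0 then \<forall>u\<in>V. degree V E u = 0
     else real (neighbor_degree_sum V E v) / real (degree V E v)
            \<ge> 2 * real (card E) / real (card V))"

definition num_groupies :: "'a set \<Rightarrow> 'a set set \<Rightarrow> nat" where
  "num_groupies V E = card {v \<in> V. groupie V E v}"

text \<open>The random graph \<open>B(n, p)\<close> on the vertex set \<open>{..<n}\<close>, as a distribution on edge
  sets: one independent Bernoulli variable per potential edge decides whether it is present.\<close>

definition random_graph :: "nat \<Rightarrow> real \<Rightarrow> nat set set pmf" where
  "random_graph n p =
    map_pmf (\<lambda>X. {e \<in> all_edges {..<n}. X e})
      (Pi_pmf (all_edges {..<n}) False (\<lambda>_. bernoulli_pmf p))"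

definition Phi :: "real \<Rightarrow> real" where
  "Phi x = cdf std_normal_distribution x"

end

theory Submission
  imports Defs "HOL-Real_Asymp.Real_Asymp"
begin

text \<open>
  Put \<open>a\<^sub>v(w) = [v ~ w] / deg v - 1 / n\<close>. Then \<open>v\<close> is a groupie iff
  \<open>X\<^sub>v = \<Sum>\<^sub>w a\<^sub>v(w) deg w\<close> is nonnegative, and \<open>\<Sum>\<^sub>w a\<^sub>v(w) = 0\<close>. Writing degrees as sums over
  edges, \<open>X\<^sub>v\<close> is a linear form in the edge indicators in which the edge \<open>{w, w'}\<close> has weight
  \<open>a\<^sub>v(w) + a\<^sub>v(w')\<close>. For two vertices \<open>u \<noteq> v\<close>, condition on all edges meeting \<open>u\<close> or \<open>v\<close>: this
  fixes \<open>a\<^sub>u\<close> and \<open>a\<^sub>v\<close>, and typically they have size \<open>O(1/n)\<close>, so the remaining centred sum has a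
  Gaussian limit. Its mean tends to \<open>1 - p\<close> and its variance, because of \<open>\<Sum>\<^sub>w a\<^sub>v(w) = 0\<close>, is about
  \<open>n p (1 - p) \<Sum>\<^sub>w a\<^sub>v(w)\<^sup>2 \<rightarrow> (1 - p)\<^sup>2\<close>, so \<open>P(X\<^sub>v \<ge> 0) \<rightarrow> \<Phi>(1)\<close>; the covariance is about
  \<open>n p (1 - p) \<Sum>\<^sub>w a\<^sub>u(w) a\<^sub>v(w) \<rightarrow> 0\<close>, since \<open>u\<close> and \<open>v\<close> have about \<open>n p\<^sup>2\<close> common neighbours. Hence
  the events "\<open>u\<close> is a groupie" and "\<open>v\<close> is a groupie" are asymptotically independent, and
  the claim follows from Chebyshev's inequality.
\<close>

section \<open>Joint convergence to independent normals\<close>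

lemma integrable_pmf_bounded:
  fixes f :: "'a \<Rightarrow> 'b::{banach, second_countable_topology}"
  assumes "\<And>x. norm (f x) \<le> B"
  shows "integrable (measure_pmf M) f"
  by (rule measure_pmf.integrable_const_bound[where B = B]) (use assms in auto)

text \<open>A law with a density has no atoms. Weak convergence yields convergence of distribution
  functions only at continuity points of the limit, so this makes it usable at every point.\<close>

lemma isCont_cdf_std_normal: "isCont (cdf std_normal_distribution) x"
proof -
  interpret real_distribution std_normal_distribution
    by (rule real_dist_normal_dist)
  have "emeasure std_normal_distribution {x} = 0"
    by (subst emeasure_density) (auto intro!: nn_integral_null_delta simp: nn_integral_0_iff_AE AE_lborel_singleton
        intro: AE_I'[of "{x}"])
  then show ?thesis
    by (simp add: isCont_cdf measure_def)
qed

text \<open>Levy's continuity theorem for the law of \<open>Z\<close> tilted by the density \<open>g\<close>; the bound \<open>1 \<le> g\<close> is there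
  to keep the normalising constant away from \<open>0\<close>.\<close>

lemma weighted_levy:
  fixes M :: "nat \<Rightarrow> 'a pmf" and Z g :: "nat \<Rightarrow> 'a \<Rightarrow> real"
  assumes g_ge: "\<And>n \<omega>. 1 \<le> g n \<omega>" and g_le: "\<And>n \<omega>. g n \<omega> \<le> C"
  assumes lim: "\<And>t. (\<lambda>n. measure_pmf.expectation (M n) (\<lambda>\<omega>. of_real (g n \<omega>) * iexp (t * Z n \<omega>)))
                 \<longlonglongrightarrow> complex_of_real (\<kappa> * exp (- t\<^sup>2 / 2))"
  shows "(\<lambda>n. measure_pmf.expectation (M n) (\<lambda>\<omega>. g n \<omega> * indicator {\<omega>. Z n \<omega> \<le> y} \<omega>)) \<longlonglongrightarrow> \<kappa> * Phi y"
proof -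
  have g_pos: "0 < g n \<omega>" for n \<omega> using g_ge[of n \<omega>] by simp
  have int_g [simp]: "integrable (measure_pmf (M n)) (g n)" for n
    by (rule integrable_pmf_bounded[of _ C]) (use g_pos g_le in \<open>auto simp: abs_of_pos\<close>)
  define m where "m n = measure_pmf.expectation (M n) (g n)" for n
  have m_ge: "1 \<le> m n" for n
  proof -
    have "measure_pmf.expectation (M n) (\<lambda>_. 1) \<le> measure_pmf.expectation (M n) (g n)"
      by (rule integral_mono) (use g_ge in auto)
    then show ?thesis by (simp add: m_def)
  qed
  \<comment> \<open>The hypothesis \<open>lim\<close> at \<open>t = 0\<close> is the convergence of
    the normalising constants.\<close>
  have m_lim: "m \<longlonglongrightarrow> \<kappa>"
  proof -
    have "(\<lambda>n. complex_of_real (m n)) \<longlonglongrightarrow> complex_of_real \<kappa>"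
      using lim[of 0] by (simp add: m_def)
    then show ?thesis by (simp only: tendsto_of_real_iff)
  qed
  have \<kappa>_ge: "1 \<le> \<kappa>"
    by (rule LIMSEQ_le_const[OF m_lim]) (use m_ge in auto)
  \<comment> \<open>\<open>D n\<close> is the law of \<open>Z n\<close> under the probability
    measure with density \<open>g n / m n\<close>. In the limit of its characteristic function the
    factor \<open>\<kappa>\<close> cancels, which leaves the standard normal one.\<close>
  define D where "D n = distr (density (measure_pmf (M n)) (\<lambda>\<omega>. ennreal (g n \<omega> / m n))) borel (Z n)" for n
  have dens_nonneg: "0 \<le> g n \<omega> / m n" for n \<omega>
    using g_pos[of n \<omega>] m_ge[of n] by simp
  have rd: "real_distribution (D n)" for n
  proof -
    have "(\<integral>\<^sup>+ \<omega>. ennreal (g n \<omega> / m n) \<partial>measure_pmf (M n)) = ennreal (measure_pmf.expectation (M n) (\<lambda>\<omega>. g n \<omega> / m n))"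
      by (rule nn_integral_eq_integral) (use dens_nonneg in auto)
    also have "measure_pmf.expectation (M n) (\<lambda>\<omega>. g n \<omega> / m n) = 1"
      using m_ge[of n] by (simp add: m_def[symmetric])
    finally have "prob_space (density (measure_pmf (M n)) (\<lambda>\<omega>. ennreal (g n \<omega> / m n)))"
      by (intro prob_spaceI) (simp add: emeasure_density)
    then show ?thesis
      unfolding D_def by (rule prob_space.real_distribution_distr) simp
  qed
  have int_D: "integral\<^sup>L (D n) f = measure_pmf.expectation (M n) (\<lambda>\<omega>. (g n \<omega> / m n) *\<^sub>R f (Z n \<omega>))"
    if [measurable]: "f \<in> borel_measurable borel" for n and f :: "real \<Rightarrow> 'c::{banach, second_countable_topology}"
    unfolding D_def by (simp add: integral_distr integral_density dens_nonneg)
  have char_D: "char (D n) t =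
      measure_pmf.expectation (M n) (\<lambda>\<omega>. of_real (g n \<omega>) * iexp (t * Z n \<omega>)) / of_real (m n)" for n t
    unfolding char_def by (subst int_D) (auto simp: scaleR_conv_of_real)
  have cdf_D: "cdf (D n) y = measure_pmf.expectation (M n) (\<lambda>\<omega>. g n \<omega> * indicator {\<omega>. Z n \<omega> \<le> y} \<omega>) / m n" for n
  proof -
    interpret D: real_distribution "D n" by (rule rd)
    have "cdf (D n) y = integral\<^sup>L (D n) (indicator {..y})"
      by (simp add: cdf_def)
    also have "\<dots> = measure_pmf.expectation (M n) (\<lambda>\<omega>. g n \<omega> * indicator {\<omega>. Z n \<omega> \<le> y} \<omega> / m n)"
      by (subst int_D) (auto simp: indicator_def intro!: Bochner_Integration.integral_cong)
    finally show ?thesis by simp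
  qed
  have "weak_conv_m D std_normal_distribution"
  proof (rule levy_continuity[OF rd real_dist_normal_dist])
    fix t
    have "(\<lambda>n. char (D n) t) \<longlonglongrightarrow> complex_of_real (\<kappa> * exp (- t\<^sup>2 / 2)) / of_real \<kappa>"
      unfolding char_D using \<kappa>_ge
      by (intro tendsto_divide lim tendsto_of_real m_lim) auto
    then show "(\<lambda>n. char (D n) t) \<longlonglongrightarrow> char std_normal_distribution t"
      using \<kappa>_ge by (simp add: char_std_normal_distribution)
  qed
  then have "(\<lambda>n. cdf (D n) y) \<longlonglongrightarrow> Phi y"
    by (simp add: weak_conv_m_def weak_conv_def isCont_cdf_std_normal Phi_def)
  then have "(\<lambda>n. m n * cdf (D n) y) \<longlonglongrightarrow> \<kappa> * Phi y"
    by (intro tendsto_mult m_lim)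
  moreover have "m n * cdf (D n) y = measure_pmf.expectation (M n) (\<lambda>\<omega>. g n \<omega> * indicator {\<omega>. Z n \<omega> \<le> y} \<omega>)" for n
    using m_ge[of n] by (simp add: cdf_D)
  ultimately show ?thesis by simp
qed

text \<open>Only the one-dimensional continuity theorem is available. Tilting by \<open>2 + cos (s Z)\<close> and
  \<open>2 + sin (s Z)\<close> turns the joint characteristic function into the limit of \<open>E [iexp (s Z) 1(Y \<le> x)]\<close>,
  and tilting by \<open>1 + 1(Y \<le> x)\<close> then yields the joint distribution function.\<close>

lemma levy_pair:
  fixes M :: "nat \<Rightarrow> 'a pmf" and Y Z :: "nat \<Rightarrow> 'a \<Rightarrow> real"
  assumes lim: "\<And>s t. (\<lambda>n. measure_pmf.expectation (M n) (\<lambda>\<omega>. iexp (s * Y n \<omega> + t * Z n \<omega>)))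
                 \<longlonglongrightarrow> complex_of_real (exp (- (s\<^sup>2 + t\<^sup>2) / 2))"
  shows "(\<lambda>n. measure_pmf.prob (M n) {\<omega>. Y n \<omega> \<le> x}) \<longlonglongrightarrow> Phi x" (is ?single)
    and "(\<lambda>n. measure_pmf.prob (M n) {\<omega>. Y n \<omega> \<le> x \<and> Z n \<omega> \<le> y}) \<longlonglongrightarrow> Phi x * Phi y" (is ?joint)
proof -
  let ?E = "\<lambda>n. measure_pmf.expectation (M n)"
  let ?B = "\<lambda>n. indicator {\<omega>. Y n \<omega> \<le> x} :: 'a \<Rightarrow> real"
  let ?e = "\<lambda>s. exp (- s\<^sup>2 / 2) :: real"
  have int: "integrable (measure_pmf (M n)) f" if "\<And>\<omega>. norm (f \<omega>) \<le> 10"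
    for n and f :: "'a \<Rightarrow> 'c::{banach, second_countable_topology}"
    using that by (rule integrable_pmf_bounded)
  have e_add: "exp (- (a\<^sup>2 + b\<^sup>2) / 2) = ?e a * ?e b" for a b :: real
    by (simp add: exp_add[symmetric] add_divide_distrib diff_divide_distrib)
  have int_B: "integrable (measure_pmf (M n)) (?B n)" for n
    by (rule int) (simp add: indicator_def)
  have single: "(\<lambda>n. ?E n (?B n)) \<longlonglongrightarrow> Phi x"
    using weighted_levy[of "\<lambda>_ _. 1" 1 M Y 1 x] lim[of _ 0] by simp
  then show ?single by simp

  have cos_lim: "(\<lambda>n. ?E n (\<lambda>\<omega>. cos (s * Z n \<omega>) * ?B n \<omega>)) \<longlonglongrightarrow> ?e s * Phi x" for s
  proof -
    \<comment> \<open>Euler's formula for \<open>cos a\<close> turns the tilted characteristic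
      function into a combination of the joint ones at \<open>(t, 0)\<close>, \<open>(t, s)\<close>
      and \<open>(t, - s)\<close>.\<close>
    have cos_exp: "of_real (2 + cos a) * iexp b = 2 * iexp b + iexp (b + a) / 2 + iexp (b - a) / 2" for a b
      by (simp add: complex_eq_iff Re_exp Im_exp cos_add sin_add cos_diff sin_diff field_simps)
    have "(\<lambda>n. ?E n (\<lambda>\<omega>. (2 + cos (s * Z n \<omega>)) * ?B n \<omega>)) \<longlonglongrightarrow> (2 + ?e s) * Phi x"
    proof (rule weighted_levy[where C = 3])
      show "1 \<le> 2 + cos (s * Z n \<omega>)" for n \<omega> using cos_ge_minus_one[of "s * Z n \<omega>"] by linarith
      show "2 + cos (s * Z n \<omega>) \<le> 3" for n \<omega> using cos_le_one[of "s * Z n \<omega>"] by linarith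
      fix t
      have "(\<lambda>n. 2 * ?E n (\<lambda>\<omega>. iexp (t * Y n \<omega> + 0 * Z n \<omega>)) + ?E n (\<lambda>\<omega>. iexp (t * Y n \<omega> + s * Z n \<omega>)) / 2
             + ?E n (\<lambda>\<omega>. iexp (t * Y n \<omega> + (- s) * Z n \<omega>)) / 2) \<longlonglongrightarrow>
             2 * complex_of_real (exp (- (t\<^sup>2 + 0\<^sup>2) / 2)) + complex_of_real (exp (- (t\<^sup>2 + s\<^sup>2) / 2)) / 2
             + complex_of_real (exp (- (t\<^sup>2 + (- s)\<^sup>2) / 2)) / 2"
        by (intro tendsto_intros lim) auto
      also have "(\<lambda>n. 2 * ?E n (\<lambda>\<omega>. iexp (t * Y n \<omega> + 0 * Z n \<omega>)) + ?E n (\<lambda>\<omega>. iexp (t * Y n \<omega> + s * Z n \<omega>)) / 2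
             + ?E n (\<lambda>\<omega>. iexp (t * Y n \<omega> + (- s) * Z n \<omega>)) / 2)
         = (\<lambda>n. ?E n (\<lambda>\<omega>. of_real (2 + cos (s * Z n \<omega>)) * iexp (t * Y n \<omega>)))"
        unfolding cos_exp by (auto simp: int)
      also have "2 * complex_of_real (exp (- (t\<^sup>2 + 0\<^sup>2) / 2)) + complex_of_real (exp (- (t\<^sup>2 + s\<^sup>2) / 2)) / 2
             + complex_of_real (exp (- (t\<^sup>2 + (- s)\<^sup>2) / 2)) / 2 = of_real ((2 + ?e s) * exp (- t\<^sup>2 / 2))"
        unfolding e_add by (simp add: algebra_simps)
      finally show "(\<lambda>n. ?E n (\<lambda>\<omega>. of_real (2 + cos (s * Z n \<omega>)) * iexp (t * Y n \<omega>)))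
          \<longlonglongrightarrow> complex_of_real ((2 + ?e s) * exp (- t\<^sup>2 / 2))" .
    qed
    \<comment> \<open>The constant 2 only served to keep the weight at least 1; its contribution is
      removed with the untilted limit \<open>single\<close>.\<close>
    then have "(\<lambda>n. ?E n (\<lambda>\<omega>. (2 + cos (s * Z n \<omega>)) * ?B n \<omega>) - 2 * ?E n (?B n)) \<longlonglongrightarrow> (2 + ?e s) * Phi x - 2 * Phi x"
      by (intro tendsto_intros single)
    moreover have "?E n (\<lambda>\<omega>. (2 + cos (s * Z n \<omega>)) * ?B n \<omega>) - 2 * ?E n (?B n)
        = ?E n (\<lambda>\<omega>. cos (s * Z n \<omega>) * ?B n \<omega>)" for n
    proof -
      have "integrable (measure_pmf (M n)) (\<lambda>\<omega>. cos (s * Z n \<omega>) * ?B n \<omega>)"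
        by (rule int) (auto simp: indicator_def intro: order_trans[OF abs_cos_le_one])
      then show ?thesis
        unfolding distrib_right by (subst Bochner_Integration.integral_add) (use int_B in auto)
    qed
    ultimately show ?thesis by (simp add: algebra_simps)
  qed

  have sin_lim: "(\<lambda>n. ?E n (\<lambda>\<omega>. sin (s * Z n \<omega>) * ?B n \<omega>)) \<longlonglongrightarrow> 0" for s
  proof -
    \<comment> \<open>The same expansion for the sine. The terms at \<open>(t, s)\<close> and
      \<open>(t, - s)\<close> have equal limits and opposite signs, so they cancel.\<close>
    have sin_exp: "of_real (2 + sin a) * iexp b = 2 * iexp b + iexp (b + a) / (2 * \<i>) - iexp (b - a) / (2 * \<i>)" for a b
      by (simp add: complex_eq_iff Re_exp Im_exp cos_add sin_add cos_diff sin_diff field_simps Re_divide Im_divide)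
    have "(\<lambda>n. ?E n (\<lambda>\<omega>. (2 + sin (s * Z n \<omega>)) * ?B n \<omega>)) \<longlonglongrightarrow> 2 * Phi x"
    proof (rule weighted_levy[where C = 3])
      show "1 \<le> 2 + sin (s * Z n \<omega>)" for n \<omega> using sin_ge_minus_one[of "s * Z n \<omega>"] by linarith
      show "2 + sin (s * Z n \<omega>) \<le> 3" for n \<omega> using sin_le_one[of "s * Z n \<omega>"] by linarith
      fix t
      have "(\<lambda>n. 2 * ?E n (\<lambda>\<omega>. iexp (t * Y n \<omega> + 0 * Z n \<omega>)) + ?E n (\<lambda>\<omega>. iexp (t * Y n \<omega> + s * Z n \<omega>)) / (2 * \<i>)
             - ?E n (\<lambda>\<omega>. iexp (t * Y n \<omega> + (- s) * Z n \<omega>)) / (2 * \<i>)) \<longlonglongrightarrow>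
             2 * complex_of_real (exp (- (t\<^sup>2 + 0\<^sup>2) / 2)) + complex_of_real (exp (- (t\<^sup>2 + s\<^sup>2) / 2)) / (2 * \<i>)
             - complex_of_real (exp (- (t\<^sup>2 + (- s)\<^sup>2) / 2)) / (2 * \<i>)"
        by (intro tendsto_intros lim) auto
      also have "(\<lambda>n. 2 * ?E n (\<lambda>\<omega>. iexp (t * Y n \<omega> + 0 * Z n \<omega>)) + ?E n (\<lambda>\<omega>. iexp (t * Y n \<omega> + s * Z n \<omega>)) / (2 * \<i>)
             - ?E n (\<lambda>\<omega>. iexp (t * Y n \<omega> + (- s) * Z n \<omega>)) / (2 * \<i>))
         = (\<lambda>n. ?E n (\<lambda>\<omega>. of_real (2 + sin (s * Z n \<omega>)) * iexp (t * Y n \<omega>)))"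
        unfolding sin_exp by (auto simp: int norm_divide norm_mult)
      finally show "(\<lambda>n. ?E n (\<lambda>\<omega>. of_real (2 + sin (s * Z n \<omega>)) * iexp (t * Y n \<omega>)))
          \<longlonglongrightarrow> complex_of_real (2 * exp (- t\<^sup>2 / 2))" by simp
    qed
    then have "(\<lambda>n. ?E n (\<lambda>\<omega>. (2 + sin (s * Z n \<omega>)) * ?B n \<omega>) - 2 * ?E n (?B n)) \<longlonglongrightarrow> 2 * Phi x - 2 * Phi x"
      by (intro tendsto_intros single)
    moreover have "?E n (\<lambda>\<omega>. (2 + sin (s * Z n \<omega>)) * ?B n \<omega>) - 2 * ?E n (?B n)
        = ?E n (\<lambda>\<omega>. sin (s * Z n \<omega>) * ?B n \<omega>)" for n
    proof -
      have "integrable (measure_pmf (M n)) (\<lambda>\<omega>. sin (s * Z n \<omega>) * ?B n \<omega>)"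
        by (rule int) (auto simp: indicator_def intro: order_trans[OF abs_sin_le_one])
      then show ?thesis
        unfolding distrib_right by (subst Bochner_Integration.integral_add) (use int_B in auto)
    qed
    ultimately show ?thesis by simp
  qed

  have "(\<lambda>n. ?E n (\<lambda>\<omega>. (1 + ?B n \<omega>) * indicator {\<omega>. Z n \<omega> \<le> y} \<omega>)) \<longlonglongrightarrow> (1 + Phi x) * Phi y"
  proof (rule weighted_levy[where C = 2])
    show "1 \<le> 1 + ?B n \<omega>" "1 + ?B n \<omega> \<le> 2" for n \<omega> by (auto simp: indicator_def)
    fix t
    \<comment> \<open>With \<open>b\<close> the indicator of \<open>Y \<le> x\<close>, this writes
      the tilted characteristic function of \<open>Z\<close> through the joint one at
      \<open>(0, t)\<close> and the quantities of \<open>cos_lim\<close> and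
      \<open>sin_lim\<close>.\<close>
    have split: "of_real (1 + b) * iexp a = iexp a + of_real (cos a * b) + \<i> * of_real (sin a * b)" for a b
      by (simp add: complex_eq_iff Re_exp Im_exp algebra_simps)
    have "(\<lambda>n. ?E n (\<lambda>\<omega>. iexp (0 * Y n \<omega> + t * Z n \<omega>)) + of_real (?E n (\<lambda>\<omega>. cos (t * Z n \<omega>) * ?B n \<omega>))
            + \<i> * of_real (?E n (\<lambda>\<omega>. sin (t * Z n \<omega>) * ?B n \<omega>))) \<longlonglongrightarrow>
          complex_of_real (exp (- (0\<^sup>2 + t\<^sup>2) / 2)) + of_real (?e t * Phi x) + \<i> * of_real 0"
      by (intro tendsto_intros lim cos_lim sin_lim)
    also have "(\<lambda>n. ?E n (\<lambda>\<omega>. iexp (0 * Y n \<omega> + t * Z n \<omega>)) + of_real (?E n (\<lambda>\<omega>. cos (t * Z n \<omega>) * ?B n \<omega>))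
            + \<i> * of_real (?E n (\<lambda>\<omega>. sin (t * Z n \<omega>) * ?B n \<omega>))) =
          (\<lambda>n. ?E n (\<lambda>\<omega>. of_real (1 + ?B n \<omega>) * iexp (t * Z n \<omega>)))"
    proof
      fix n
      have 1: "integrable (measure_pmf (M n)) (\<lambda>\<omega>. cos (t * Z n \<omega>) * ?B n \<omega>)"
        by (rule int) (auto simp: indicator_def intro: order_trans[OF abs_cos_le_one])
      have 2: "integrable (measure_pmf (M n)) (\<lambda>\<omega>. sin (t * Z n \<omega>) * ?B n \<omega>)"
        by (rule int) (auto simp: indicator_def intro: order_trans[OF abs_sin_le_one])
      have 3: "integrable (measure_pmf (M n)) (\<lambda>\<omega>. iexp (t * Z n \<omega>))"
        by (rule int) auto
      show "?E n (\<lambda>\<omega>. iexp (0 * Y n \<omega> + t * Z n \<omega>)) + of_real (?E n (\<lambda>\<omega>. cos (t * Z n \<omega>) * ?B n \<omega>))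
            + \<i> * of_real (?E n (\<lambda>\<omega>. sin (t * Z n \<omega>) * ?B n \<omega>)) =
           ?E n (\<lambda>\<omega>. of_real (1 + ?B n \<omega>) * iexp (t * Z n \<omega>))"
        unfolding split using 3
        by (simp del: of_real_mult
            add: integrable_of_real[OF 1] integrable_of_real[OF 2] of_real_mult[of t])
    qed
    finally show "(\<lambda>n. ?E n (\<lambda>\<omega>. of_real (1 + ?B n \<omega>) * iexp (t * Z n \<omega>)))
        \<longlonglongrightarrow> complex_of_real ((1 + Phi x) * exp (- t\<^sup>2 / 2))"
      by (simp add: algebra_simps)
  qed
  moreover have "(\<lambda>n. ?E n (indicator {\<omega>. Z n \<omega> \<le> y})) \<longlonglongrightarrow> Phi y"
    using weighted_levy[of "\<lambda>_ _. 1" 1 M Z 1 y] lim[of 0 _] by simp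
  ultimately have "(\<lambda>n. ?E n (\<lambda>\<omega>. (1 + ?B n \<omega>) * indicator {\<omega>. Z n \<omega> \<le> y} \<omega>) - ?E n (indicator {\<omega>. Z n \<omega> \<le> y}))
      \<longlonglongrightarrow> (1 + Phi x) * Phi y - Phi y"
    by (rule tendsto_diff)
  also have "(\<lambda>n. ?E n (\<lambda>\<omega>. (1 + ?B n \<omega>) * indicator {\<omega>. Z n \<omega> \<le> y} \<omega>) - ?E n (indicator {\<omega>. Z n \<omega> \<le> y})) =
      (\<lambda>n. measure_pmf.prob (M n) {\<omega>. Y n \<omega> \<le> x \<and> Z n \<omega> \<le> y})"
  proof
    fix n
    have "?E n (\<lambda>\<omega>. (1 + ?B n \<omega>) * indicator {\<omega>. Z n \<omega> \<le> y} \<omega>) =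
        ?E n (\<lambda>\<omega>. indicator {\<omega>. Z n \<omega> \<le> y} \<omega> + indicator {\<omega>. Y n \<omega> \<le> x \<and> Z n \<omega> \<le> y} \<omega>)"
      by (rule Bochner_Integration.integral_cong) (auto simp: indicator_def)
    also have "\<dots> = ?E n (indicator {\<omega>. Z n \<omega> \<le> y}) + ?E n (indicator {\<omega>. Y n \<omega> \<le> x \<and> Z n \<omega> \<le> y})"
      by (rule Bochner_Integration.integral_add) (auto intro!: int simp: indicator_def)
    finally show "?E n (\<lambda>\<omega>. (1 + ?B n \<omega>) * indicator {\<omega>. Z n \<omega> \<le> y} \<omega>) - ?E n (indicator {\<omega>. Z n \<omega> \<le> y}) =
      measure_pmf.prob (M n) {\<omega>. Y n \<omega> \<le> x \<and> Z n \<omega> \<le> y}" by simp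
  qed
  finally show ?joint by (simp add: algebra_simps)
qed

section \<open>Products of Bernoulli distributions\<close>

text \<open>Fubini as a rearrangement of finite sums: with finite supports no integrability of
  \<open>f\<close> has to be checked.\<close>

lemma expectation_pair_pmf_finite:
  fixes f :: "'a \<times> 'b \<Rightarrow> 'c::{banach, second_countable_topology}"
  assumes "finite (set_pmf M)" "finite (set_pmf N)"
  shows "measure_pmf.expectation (pair_pmf M N) f =
    measure_pmf.expectation M (\<lambda>x. measure_pmf.expectation N (\<lambda>y. f (x, y)))"
proof -
  have "measure_pmf.expectation (pair_pmf M N) f =
      (\<Sum>z\<in>set_pmf M \<times> set_pmf N. pmf (pair_pmf M N) z *\<^sub>R f z)"
    by (rule integral_measure_pmf) (use assms in auto)
  also have "\<dots> = (\<Sum>x\<in>set_pmf M. pmf M x *\<^sub>R (\<Sum>y\<in>set_pmf N. pmf N y *\<^sub>R f (x, y)))"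
    by (simp add: sum.cartesian_product' pmf_pair scaleR_sum_right)
  also have "\<dots> = (\<Sum>x\<in>set_pmf M. pmf M x *\<^sub>R measure_pmf.expectation N (\<lambda>y. f (x, y)))"
    by (intro sum.cong refl, subst integral_measure_pmf[OF assms(2)]) auto
  also have "\<dots> = measure_pmf.expectation M (\<lambda>x. measure_pmf.expectation N (\<lambda>y. f (x, y)))"
    by (subst integral_measure_pmf[OF assms(1)]) auto
  finally show ?thesis .
qed

lemma finite_set_Pi_pmf:
  assumes "finite A" "\<And>x. finite (set_pmf (p x))"
  shows "finite (set_pmf (Pi_pmf A dflt p))"
  using assms by (auto simp: set_Pi_pmf intro!: finite_PiE_dflt)

text \<open>This is the form in which conditioning is used: the inner expectation redraws the
  coordinates in \<open>B\<close> while those in \<open>A\<close> stay fixed.\<close>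

lemma expectation_Pi_pmf_union:
  fixes f :: "_ \<Rightarrow> 'c::{banach, second_countable_topology}"
  assumes "finite A" "finite B" "A \<inter> B = {}" "\<And>x. finite (set_pmf (p x))"
  shows "measure_pmf.expectation (Pi_pmf (A \<union> B) dflt p) f =
    measure_pmf.expectation (Pi_pmf A dflt p) (\<lambda>X. measure_pmf.expectation (Pi_pmf B dflt p)
      (\<lambda>Y. f (\<lambda>e. if e \<in> A then X e else Y e)))"
  using assms by (simp add: Pi_pmf_union expectation_pair_pmf_finite finite_set_Pi_pmf)

lemma expectation_prod_Pi_pmf_finite:
  fixes f :: "_ \<Rightarrow> _ \<Rightarrow> 'c::{banach, second_countable_topology, real_normed_field}"
  assumes "finite A" and fin: "\<And>x. finite (set_pmf (p x))"
  shows "measure_pmf.expectation (Pi_pmf A dflt p) (\<lambda>X. \<Prod>e\<in>A. f e (X e)) =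
    (\<Prod>e\<in>A. measure_pmf.expectation (p e) (f e))"
  using assms(1)
proof (induction A rule: finite_induct)
  case (insert x A)
  have cong: "(\<Prod>e\<in>A. f e (if e = x then y else X e)) = (\<Prod>e\<in>A. f e (X e))" for y X
    using insert.hyps by (intro prod.cong) auto
  show ?case
    using insert
    by (simp add: Pi_pmf_insert expectation_pair_pmf_finite finite_set_Pi_pmf fin case_prod_unfold cong)
qed simp

text \<open>The first term is the characteristic function of \<open>c\<close> times a centred
  Bernoulli variable, which has mean 0 and variance \<open>p * (1 - p)\<close>. Both terms therefore
  agree with \<open>1 - p * (1 - p) * c^2 / 2\<close> up to third order: the Taylor remainders give
  \<open>\<bar>c\<bar>^3 / 6\<close>, and the Gaussian factor gives at most
  \<open>\<bar>c\<bar>^3\<close>.\<close>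

lemma char_bernoulli_approx:
  fixes p c :: real
  assumes p: "0 \<le> p" "p \<le> 1" and c: "\<bar>c\<bar> \<le> 1"
  shows "norm (p * iexp (c * (1 - p)) + (1 - p) * iexp (- (c * p)) - exp (- (p * (1 - p) * c\<^sup>2) / 2)) \<le> 2 * \<bar>c\<bar> ^ 3"
proof -
  have taylor: "norm (iexp x - (1 + \<i> * x - x\<^sup>2 / 2)) \<le> \<bar>c\<bar> ^ 3 / 6" if "\<bar>x\<bar> \<le> \<bar>c\<bar>" for x :: real
  proof -
    have "(\<Sum>k\<le>2. (\<i> * x) ^ k / fact k) = 1 + \<i> * x - x\<^sup>2 / 2"
      by (simp add: eval_nat_numeral complex_eq_iff)
    then have "norm (iexp x - (1 + \<i> * x - x\<^sup>2 / 2)) \<le> \<bar>x\<bar> ^ 3 / 6"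
      using iexp_approx1[of x 2] by (simp add: eval_nat_numeral)
    also have "\<dots> \<le> \<bar>c\<bar> ^ 3 / 6" using that by (intro divide_right_mono power_mono) auto
    finally show ?thesis .
  qed
  define T1 T2 where "T1 = iexp (c * (1 - p)) - (1 + \<i> * (c * (1 - p)) - (c * (1 - p))\<^sup>2 / 2)"
    and "T2 = iexp (- (c * p)) - (1 + \<i> * (- (c * p)) - (- (c * p))\<^sup>2 / 2)"
  have "\<bar>c * (1 - p)\<bar> \<le> \<bar>c\<bar>" "\<bar>- (c * p)\<bar> \<le> \<bar>c\<bar>"
    using p by (auto simp: abs_mult intro: mult_left_le)
  from this[THEN taylor] have T: "norm T1 \<le> \<bar>c\<bar> ^ 3 / 6" "norm T2 \<le> \<bar>c\<bar> ^ 3 / 6"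
    unfolding T1_def T2_def by (auto simp del: of_real_mult of_real_minus of_real_power)
  define y where "y = p * (1 - p) * c\<^sup>2 / 2"
  have c2: "c\<^sup>2 \<le> 1" using c by (simp add: abs_square_le_1)
  have pp: "p * (1 - p) \<le> 1" using p by (simp add: mult_le_one)
  have y0: "0 \<le> y" using p by (simp add: y_def)
  have y_le: "y \<le> c\<^sup>2" using mult_right_mono[OF pp, of "c\<^sup>2"] zero_le_power2[of c] unfolding y_def by linarith
  \<comment> \<open>The chain is
    \<open>1 - y \<le> exp (- y) \<le> 1 / (1 + y) \<le> 1 - y + y^2\<close>.\<close>
  have exp_y: "\<bar>exp (- y) - (1 - y)\<bar> \<le> y\<^sup>2"
  proof -
    have "exp (- y) \<le> 1 / (1 + y)"
      using exp_ge_add_one_self[of y] y0 by (simp add: exp_minus field_simps)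
    also have "\<dots> \<le> 1 - y + y\<^sup>2"
      using y0 by (simp add: field_simps power2_eq_square)
    finally show ?thesis using exp_ge_add_one_self[of "- y"] by (auto simp: abs_le_iff)
  qed
  have "y\<^sup>2 \<le> (c\<^sup>2)\<^sup>2" using y0 y_le by (intro power_mono)
  also have "\<dots> = \<bar>c\<bar> ^ 3 * \<bar>c\<bar>" by (simp add: eval_nat_numeral)
  also have "\<dots> \<le> \<bar>c\<bar> ^ 3" using c by (intro mult_left_le) auto
  finally have y2: "y\<^sup>2 \<le> \<bar>c\<bar> ^ 3" .
  have "p * iexp (c * (1 - p)) + (1 - p) * iexp (- (c * p)) - exp (- (p * (1 - p) * c\<^sup>2) / 2)
      = p * T1 + (1 - p) * T2 - of_real (exp (- y) - (1 - y))"
    by (simp add: T1_def T2_def y_def field_simps power2_eq_square)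
  also have "norm \<dots> \<le> norm (p * T1) + norm ((1 - p) * T2) + norm (complex_of_real (exp (- y) - (1 - y)))"
    by (intro order_trans[OF norm_triangle_ineq4] add_right_mono norm_triangle_ineq)
  also have "\<dots> \<le> p * (\<bar>c\<bar> ^ 3 / 6) + (1 - p) * (\<bar>c\<bar> ^ 3 / 6) + \<bar>c\<bar> ^ 3"
    unfolding norm_mult norm_of_real
    using p T exp_y y2 by (intro add_mono mult_mono) (auto simp: norm_mult simp flip: of_real_diff)
  also have "\<dots> = \<bar>c\<bar> ^ 3 / 6 + \<bar>c\<bar> ^ 3"
    unfolding distrib_right[symmetric] by simp
  also have "\<dots> \<le> 2 * \<bar>c\<bar> ^ 3" by simp
  finally show ?thesis .
qed

text \<open>A quantitative central limit theorem. By independence both sides are products of factors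
  in the closed unit disc, so the products differ by at most the sum of the differences of the
  factors, and each \<open>\<bar>c e\<bar>^3\<close> is at most \<open>K * (c e)^2\<close>. The
  error vanishes when the weights become uniformly small while their squared norm stays
  bounded.\<close>

lemma char_weighted_bernoulli:
  fixes c :: "'a \<Rightarrow> real" and p K :: real
  assumes fin: "finite T" and p: "0 \<le> p" "p \<le> 1" and c: "\<And>e. e \<in> T \<Longrightarrow> \<bar>c e\<bar> \<le> K" and K: "K \<le> 1"
  shows "norm (measure_pmf.expectation (Pi_pmf T False (\<lambda>_. bernoulli_pmf p))
      (\<lambda>X. iexp (\<Sum>e\<in>T. c e * (of_bool (X e) - p))) - exp (- (p * (1 - p) * (\<Sum>e\<in>T. (c e)\<^sup>2)) / 2))
     \<le> 2 * K * (\<Sum>e\<in>T. (c e)\<^sup>2)"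
proof -
  define \<psi> where "\<psi> e = p * iexp (c e * (1 - p)) + (1 - p) * iexp (- (c e * p))" for e
  have "measure_pmf.expectation (Pi_pmf T False (\<lambda>_. bernoulli_pmf p)) (\<lambda>X. iexp (\<Sum>e\<in>T. c e * (of_bool (X e) - p)))
      = measure_pmf.expectation (Pi_pmf T False (\<lambda>_. bernoulli_pmf p)) (\<lambda>X. \<Prod>e\<in>T. iexp (c e * (of_bool (X e) - p)))"
    using fin by (simp add: exp_sum sum_distrib_left)
  also have "\<dots> = (\<Prod>e\<in>T. measure_pmf.expectation (bernoulli_pmf p) (\<lambda>b. iexp (c e * (of_bool b - p))))"
    using fin by (rule expectation_prod_Pi_pmf_finite) (rule finite_subset[OF subset_UNIV], simp)
  also have "\<dots> = (\<Prod>e\<in>T. \<psi> e)"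
    using p by (intro prod.cong refl)
      (auto simp: \<psi>_def integral_measure_pmf[of UNIV] UNIV_bool scaleR_conv_of_real)
  finally have prod: "measure_pmf.expectation (Pi_pmf T False (\<lambda>_. bernoulli_pmf p))
      (\<lambda>X. iexp (\<Sum>e\<in>T. c e * (of_bool (X e) - p))) = (\<Prod>e\<in>T. \<psi> e)" .
  have "exp (- (p * (1 - p) * (\<Sum>e\<in>T. (c e)\<^sup>2)) / 2) = (\<Prod>e\<in>T. exp (- (p * (1 - p) * (c e)\<^sup>2) / 2))"
    using fin by (simp add: exp_sum[symmetric] sum_distrib_left sum_negf sum_divide_distrib)
  then have "norm ((\<Prod>e\<in>T. \<psi> e) - exp (- (p * (1 - p) * (\<Sum>e\<in>T. (c e)\<^sup>2)) / 2))
     = norm ((\<Prod>e\<in>T. \<psi> e) - (\<Prod>e\<in>T. complex_of_real (exp (- (p * (1 - p) * (c e)\<^sup>2) / 2))))"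
    by simp
  also have "\<dots> \<le> (\<Sum>e\<in>T. norm (\<psi> e - exp (- (p * (1 - p) * (c e)\<^sup>2) / 2)))"
  proof (rule norm_prod_diff)
    fix e assume "e \<in> T"
    have "norm (\<psi> e) \<le> norm (p * iexp (c e * (1 - p))) + norm ((1 - p) * iexp (- (c e * p)))"
      unfolding \<psi>_def by (rule norm_triangle_ineq)
    also have "\<dots> = 1"
      unfolding norm_mult norm_exp_i_times using p by (simp flip: of_real_diff)
    finally show "norm (\<psi> e) \<le> 1" .
    show "norm (complex_of_real (exp (- (p * (1 - p) * (c e)\<^sup>2) / 2))) \<le> 1"
      using p by (simp del: of_real_exp)
  qed
  also have "\<dots> \<le> (\<Sum>e\<in>T. 2 * K * (c e)\<^sup>2)"
  proof (rule sum_mono)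
    fix e assume e: "e \<in> T"
    have "norm (\<psi> e - exp (- (p * (1 - p) * (c e)\<^sup>2) / 2)) \<le> 2 * \<bar>c e\<bar> ^ 3"
      unfolding \<psi>_def using p c[OF e] K by (intro char_bernoulli_approx) auto
    also have "\<dots> = 2 * (\<bar>c e\<bar> * (c e)\<^sup>2)" by (simp add: eval_nat_numeral)
    also have "\<dots> \<le> 2 * (K * (c e)\<^sup>2)" using c[OF e] by (intro mult_left_mono mult_right_mono) auto
    finally show "norm (\<psi> e - exp (- (p * (1 - p) * (c e)\<^sup>2) / 2)) \<le> 2 * K * (c e)\<^sup>2" by simp
  qed
  finally show ?thesis unfolding prod sum_distrib_left[of "2 * K"] .
qed

lemma prob_Pi_pmf_bernoulli_all:
  assumes "finite A" "B \<subseteq> A" "0 \<le> p" "p \<le> 1"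
  shows "measure_pmf.prob (Pi_pmf A False (\<lambda>_. bernoulli_pmf p)) {X. \<forall>e\<in>B. X e} = p ^ card B"
proof -
  have "{X. \<forall>e\<in>B. X e} = Pi A (\<lambda>e. if e \<in> B then {True} else UNIV)"
    using assms(2) by (auto simp: Pi_def split: if_splits)
  then have "measure_pmf.prob (Pi_pmf A False (\<lambda>_. bernoulli_pmf p)) {X. \<forall>e\<in>B. X e} =
      (\<Prod>e\<in>A. if e \<in> B then p else 1)"
    using assms by (simp add: measure_Pi_pmf_Pi if_distrib measure_pmf_single cong: if_cong)
  also have "\<dots> = p ^ card B"
    using assms by (simp add: prod.If_cases Int_absorb1)
  finally show ?thesis .
qed

text \<open>Disjoint blocks give independent events, so the covariances vanish and the variance of
  the count is at most \<open>card I\<close>. Blocks of size 1 will count neighbours, blocks of size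
  2 common neighbours.\<close>

lemma chebyshev_disjoint_cylinders:
  fixes p \<delta> :: real and B :: "'i \<Rightarrow> 'a set"
  assumes A: "finite A" and p: "0 \<le> p" "p \<le> 1" and I: "finite I" and B: "\<And>i. i \<in> I \<Longrightarrow> B i \<subseteq> A"
    and card: "\<And>i. i \<in> I \<Longrightarrow> card (B i) = k" and disj: "disjoint_family_on B I" and \<delta>: "0 < \<delta>"
  shows "measure_pmf.prob (Pi_pmf A False (\<lambda>_. bernoulli_pmf p))
      {X. \<delta> \<le> \<bar>real (card {i\<in>I. \<forall>e\<in>B i. X e}) - real (card I) * p ^ k\<bar>} \<le> real (card I) / \<delta>\<^sup>2"
proof -
  let ?M = "Pi_pmf A False (\<lambda>_. bernoulli_pmf p)"
  let ?E = "measure_pmf.expectation ?M"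
  let ?\<mu> = "p ^ k"
  define Z :: "'i \<Rightarrow> ('a \<Rightarrow> bool) \<Rightarrow> real" where "Z i X = indicator {X. \<forall>e\<in>B i. X e} X" for i X
  have int [simp]: "integrable (measure_pmf ?M) f" for f :: "_ \<Rightarrow> real"
    by (rule integrable_measure_pmf_finite, rule finite_set_Pi_pmf[OF A], rule finite_subset[OF subset_UNIV], simp)
  have EZ: "?E (Z i) = ?\<mu>" if "i \<in> I" for i
    using prob_Pi_pmf_bernoulli_all[OF A B[OF that] p] that by (simp add: Z_def[abs_def] card)
  have EZZ: "?E (\<lambda>X. Z i X * Z j X) = (if i = j then ?\<mu> else ?\<mu> * ?\<mu>)" if ij: "i \<in> I" "j \<in> I" for i j
  proof (cases "i = j")
    case True
    have "?E (\<lambda>X. Z i X * Z i X) = ?E (Z i)"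
      by (rule Bochner_Integration.integral_cong) (auto simp: Z_def indicator_def)
    then show ?thesis using True EZ[OF ij(1)] by simp
  next
    case False
    have "B i \<inter> B j = {}" using disj ij False by (auto simp: disjoint_family_on_def)
    moreover have "finite (B i)" "finite (B j)" using B ij A by (auto intro: finite_subset)
    ultimately have c: "card (B i \<union> B j) = k + k" using card ij by (simp add: card_Un_disjoint)
    have "?E (\<lambda>X. Z i X * Z j X) = ?E (indicator {X. \<forall>e\<in>B i \<union> B j. X e})"
      by (rule Bochner_Integration.integral_cong) (auto simp: Z_def indicator_def)
    also have "\<dots> = p ^ (k + k)"
      using prob_Pi_pmf_bernoulli_all[OF A _ p, of "B i \<union> B j"] B ij by (simp add: c)
    finally show ?thesis using False by (simp add: power_add)
  qed
  have sum_Z: "real (card {i\<in>I. \<forall>e\<in>B i. X e}) = (\<Sum>i\<in>I. Z i X)" for X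
    using I by (simp add: Z_def indicator_def sum.If_cases Int_def)
  have "?E (\<lambda>X. (real (card {i\<in>I. \<forall>e\<in>B i. X e}) - real (card I) * ?\<mu>)\<^sup>2)
      = ?E (\<lambda>X. \<Sum>i\<in>I. \<Sum>j\<in>I. Z i X * Z j X - ?\<mu> * Z i X - ?\<mu> * Z j X + ?\<mu> * ?\<mu>)"
  proof (rule Bochner_Integration.integral_cong)
    fix X
    have "real (card {i\<in>I. \<forall>e\<in>B i. X e}) - real (card I) * ?\<mu> = (\<Sum>i\<in>I. Z i X - ?\<mu>)"
      by (simp add: sum_Z sum_subtractf)
    then show "(real (card {i\<in>I. \<forall>e\<in>B i. X e}) - real (card I) * ?\<mu>)\<^sup>2
        = (\<Sum>i\<in>I. \<Sum>j\<in>I. Z i X * Z j X - ?\<mu> * Z i X - ?\<mu> * Z j X + ?\<mu> * ?\<mu>)"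
      by (simp add: power2_eq_square sum_product algebra_simps)
  qed simp
  also have "\<dots> = (\<Sum>i\<in>I. \<Sum>j\<in>I. if i = j then ?\<mu> - ?\<mu> * ?\<mu> else 0)"
    by (auto simp: EZ EZZ intro!: sum.cong)
  also have "\<dots> = real (card I) * (?\<mu> - ?\<mu> * ?\<mu>)" using I by simp
  also have "\<dots> \<le> real (card I) * 1"
    using power_le_one[OF p, of k] zero_le_square[of ?\<mu>] by (intro mult_left_mono) linarith+
  finally have second: "?E (\<lambda>X. (real (card {i\<in>I. \<forall>e\<in>B i. X e}) - real (card I) * ?\<mu>)\<^sup>2) \<le> real (card I)" by simp
  have "measure_pmf.prob ?M {X. \<delta> \<le> \<bar>real (card {i\<in>I. \<forall>e\<in>B i. X e}) - real (card I) * ?\<mu>\<bar>}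
    = measure_pmf.prob ?M {X \<in> space ?M. \<delta>\<^sup>2 \<le> (real (card {i\<in>I. \<forall>e\<in>B i. X e}) - real (card I) * ?\<mu>)\<^sup>2}"
    using \<delta> abs_le_square_iff[of \<delta>] by simp
  also have "\<dots> \<le> ?E (\<lambda>X. (real (card {i\<in>I. \<forall>e\<in>B i. X e}) - real (card I) * ?\<mu>)\<^sup>2) / \<delta>\<^sup>2"
    using \<delta> by (intro integral_Markov_inequality_measure[where A = "{}"]) auto
  also have "\<dots> \<le> real (card I) / \<delta>\<^sup>2"
    by (intro divide_right_mono second) simp
  finally show ?thesis .
qed

section \<open>Edge weights and the groupie excess\<close>

lemma finite_all_edges: "finite V \<Longrightarrow> finite (all_edges V)"
  by (rule finite_subset[of _ "Pow V"]) (auto simp: all_edges_def)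

lemma insert_in_all_edges_iff: "{u, w} \<in> all_edges V \<longleftrightarrow> u \<in> V \<and> w \<in> V \<and> u \<noteq> w"
  by (cases "u = w") (auto simp: all_edges_def)

text \<open>Each edge comes from exactly two ordered pairs of distinct vertices.\<close>

lemma sum_all_edges:
  fixes f :: "'a set \<Rightarrow> real"
  assumes V: "finite V"
  shows "(\<Sum>u\<in>V. \<Sum>w\<in>V - {u}. f {u, w}) = 2 * (\<Sum>e\<in>all_edges V. f e)"
proof -
  let ?S = "Sigma V (\<lambda>u. V - {u})"
  have fin: "finite ?S" using V by auto
  have "(\<Sum>u\<in>V. \<Sum>w\<in>V - {u}. f {u, w}) = (\<Sum>z\<in>?S. f {fst z, snd z})"
    using V by (simp add: sum.Sigma split_beta)
  also have "\<dots> = (\<Sum>e\<in>all_edges V. \<Sum>z\<in>{z \<in> ?S. {fst z, snd z} = e}. f {fst z, snd z})"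
    by (rule sum.group[symmetric]) (use fin V in \<open>auto simp: finite_all_edges insert_in_all_edges_iff\<close>)
  also have "\<dots> = (\<Sum>e\<in>all_edges V. 2 * f e)"
  proof (intro sum.cong refl)
    fix e assume "e \<in> all_edges V"
    then obtain a b where e: "e = {a, b}" "a \<noteq> b" "a \<in> V" "b \<in> V"
      by (auto simp: all_edges_def card_2_iff)
    then have "{z \<in> ?S. {fst z, snd z} = e} = {(a, b), (b, a)}"
      by (auto simp: doubleton_eq_iff)
    then show "(\<Sum>z\<in>{z \<in> ?S. {fst z, snd z} = e}. f {fst z, snd z}) = 2 * f e"
      using e by (auto simp: insert_commute)
  qed
  finally show ?thesis by (simp add: sum_distrib_left)
qed

text \<open>Every vertex lies in \<open>card V - 1\<close> edges of the complete graph.\<close>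

lemma sum_edge_weights:
  fixes a :: "'a \<Rightarrow> real"
  assumes V: "finite V"
  shows "(\<Sum>e\<in>all_edges V. \<Sum>w\<in>e. a w) = (real (card V) - 1) * (\<Sum>w\<in>V. a w)"
proof -
  have "2 * (\<Sum>e\<in>all_edges V. \<Sum>w\<in>e. a w) = (\<Sum>u\<in>V. \<Sum>w\<in>V - {u}. \<Sum>x\<in>{u, w}. a x)"
    by (rule sum_all_edges[OF V, symmetric])
  also have "\<dots> = (\<Sum>u\<in>V. \<Sum>w\<in>V - {u}. a u + a w)" by (intro sum.cong) auto
  also have "\<dots> = (\<Sum>u\<in>V. (real (card V) - 2) * a u + (\<Sum>w\<in>V. a w))"
  proof (rule sum.cong[OF refl])
    fix u assume u: "u \<in> V"
    then have "card V \<ge> 1" using V by (simp add: Suc_le_eq card_gt_0_iff) blast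
    then show "(\<Sum>w\<in>V - {u}. a u + a w) = (real (card V) - 2) * a u + (\<Sum>w\<in>V. a w)"
      using V u by (simp add: sum.distrib sum_diff1 of_nat_diff algebra_simps)
  qed
  also have "\<dots> = 2 * ((real (card V) - 1) * (\<Sum>w\<in>V. a w))"
    unfolding sum.distrib sum_distrib_left[symmetric] by (simp add: algebra_simps)
  finally show ?thesis by simp
qed

text \<open>Expanding the squares, each \<open>(a w)^2\<close> occurs \<open>card V - 1\<close>
  times, and the mixed terms add up to the square of the total minus the sum of squares.\<close>

lemma sum_edge_weights_squared:
  fixes a :: "'a \<Rightarrow> real"
  assumes V: "finite V"
  shows "(\<Sum>e\<in>all_edges V. (\<Sum>w\<in>e. a w)\<^sup>2) = (real (card V) - 2) * (\<Sum>w\<in>V. (a w)\<^sup>2) + (\<Sum>w\<in>V. a w)\<^sup>2"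
proof -
  have "2 * (\<Sum>e\<in>all_edges V. (\<Sum>w\<in>e. a w)\<^sup>2) = (\<Sum>u\<in>V. \<Sum>w\<in>V - {u}. (\<Sum>x\<in>{u, w}. a x)\<^sup>2)"
    by (rule sum_all_edges[OF V, symmetric])
  also have "\<dots> = (\<Sum>u\<in>V. \<Sum>w\<in>V - {u}. (a u + a w)\<^sup>2)" by (intro sum.cong) auto
  also have "\<dots> = (\<Sum>u\<in>V. (real (card V) - 4) * (a u)\<^sup>2 + 2 * a u * (\<Sum>w\<in>V. a w) + (\<Sum>w\<in>V. (a w)\<^sup>2))"
  proof (rule sum.cong[OF refl])
    fix u assume u: "u \<in> V"
    have "(\<Sum>w\<in>V - {u}. (a u + a w)\<^sup>2) = (\<Sum>w\<in>V. (a u + a w)\<^sup>2) - (a u + a u)\<^sup>2"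
      using V u by (simp add: sum_diff1)
    also have "(\<Sum>w\<in>V. (a u + a w)\<^sup>2) = card V * (a u)\<^sup>2 + 2 * a u * (\<Sum>w\<in>V. a w) + (\<Sum>w\<in>V. (a w)\<^sup>2)"
      by (simp add: power2_sum sum.distrib flip: sum_distrib_left)
    finally show "(\<Sum>w\<in>V - {u}. (a u + a w)\<^sup>2) =
        (real (card V) - 4) * (a u)\<^sup>2 + 2 * a u * (\<Sum>w\<in>V. a w) + (\<Sum>w\<in>V. (a w)\<^sup>2)"
      by (simp add: algebra_simps power2_eq_square)
  qed
  also have "\<dots> = 2 * ((real (card V) - 2) * (\<Sum>w\<in>V. (a w)\<^sup>2) + (\<Sum>w\<in>V. a w)\<^sup>2)"
    unfolding sum.distrib sum_distrib_left[symmetric] sum_distrib_right[symmetric]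
    by (simp add: power2_eq_square algebra_simps)
  finally show ?thesis by simp
qed

lemma sum_over_incident_edges:
  assumes V: "finite V" and E: "E \<subseteq> all_edges V" and u: "u \<in> V"
  shows "(\<Sum>e | e \<in> E \<and> u \<in> e. f e) = (\<Sum>w\<in>neighbors V E u. f {u, w})"
proof (rule sum.reindex_bij_betw[symmetric])
  have "inj_on (\<lambda>w. {u, w}) (neighbors V E u)" by (auto simp: inj_on_def doubleton_eq_iff)
  moreover have "(\<lambda>w. {u, w}) ` neighbors V E u = {e \<in> E. u \<in> e}"
  proof safe
    fix e assume e: "e \<in> E" "u \<in> e"
    then obtain x y where "e = {x, y}" "x \<in> V" "y \<in> V" using E by (auto simp: all_edges_def card_2_iff)
    then show "e \<in> (\<lambda>w. {u, w}) ` neighbors V E u"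
      using e by (auto simp: neighbors_def insert_commute)
  qed (auto simp: neighbors_def)
  ultimately show "bij_betw (\<lambda>w. {u, w}) (neighbors V E u) {e \<in> E. u \<in> e}"
    by (simp add: bij_betw_def)
qed

text \<open>Double counting of incident pairs of a vertex and an edge. It turns the excess into a
  linear form in the edge indicators, and constant weight 1 gives the handshake identity.\<close>

lemma sum_weighted_degrees:
  fixes a :: "'a \<Rightarrow> real"
  assumes V: "finite V" and E: "E \<subseteq> all_edges V"
  shows "(\<Sum>w\<in>V. a w * degree V E w) = (\<Sum>e\<in>E. \<Sum>w\<in>e. a w)"
proof -
  have fin: "finite E" using finite_subset[OF E finite_all_edges[OF V]] .
  have deg: "real (degree V E w) = (\<Sum>e\<in>E. if w \<in> e then 1 else 0)" if "w \<in> V" for w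
    using sum_over_incident_edges[OF V E that, of "\<lambda>_. 1 :: real"] fin
    by (simp add: degree_def sum.If_cases Int_def)
  have "(\<Sum>w\<in>V. a w * degree V E w) = (\<Sum>w\<in>V. \<Sum>e\<in>E. if w \<in> e then a w else 0)"
    by (auto simp: deg sum_distrib_left intro!: sum.cong)
  also have "\<dots> = (\<Sum>e\<in>E. \<Sum>w\<in>V. if w \<in> e then a w else 0)" by (rule sum.swap)
  also have "\<dots> = (\<Sum>e\<in>E. \<Sum>w\<in>e. a w)"
  proof (rule sum.cong[OF refl])
    fix e assume "e \<in> E"
    then have "e \<subseteq> V" using E by (auto simp: all_edges_def)
    then show "(\<Sum>w\<in>V. if w \<in> e then a w else 0) = (\<Sum>w\<in>e. a w)"
      using V by (simp add: sum.If_cases Int_def Collect_conj_eq[symmetric] Int_absorb1 cong: conj_cong)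
        (metis Collect_mem_eq Int_absorb1 Int_def)
  qed
  finally show ?thesis .
qed

text \<open>For isolated \<open>v\<close> the quotient by \<open>degree V E v = 0\<close> is \<open>0\<close>, so the excess is minus the average degree;
  this matches the convention that \<open>v\<close> is then a groupie iff there are no edges.\<close>

definition groupie_weight :: "'a set \<Rightarrow> 'a set set \<Rightarrow> 'a \<Rightarrow> 'a \<Rightarrow> real" where
  "groupie_weight V E v w = of_bool ({v, w} \<in> E) / degree V E v - 1 / card V"

definition groupie_excess :: "'a set \<Rightarrow> 'a set set \<Rightarrow> 'a \<Rightarrow> real" where
  "groupie_excess V E v = (\<Sum>w\<in>V. groupie_weight V E v w * degree V E w)"

lemma sum_neighbors:
  fixes f :: "'a \<Rightarrow> real"
  assumes "finite V"
  shows "(\<Sum>w\<in>V. of_bool ({v, w} \<in> E) * f w) = (\<Sum>w\<in>neighbors V E v. f w)"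
  by (rule sum.mono_neutral_cong_right) (use assms in \<open>auto simp: neighbors_def\<close>)

text \<open>By the handshake identity the average of all degrees is
  \<open>2 * card E / card V\<close>, so for non-isolated \<open>v\<close> the excess is the
  difference of the two averages being compared.\<close>

lemma groupie_iff_excess:
  assumes V: "finite V" and E: "E \<subseteq> all_edges V" and v: "v \<in> V"
  shows "groupie V E v \<longleftrightarrow> 0 \<le> groupie_excess V E v"
proof -
  have card_V: "0 < card V" using V v by (auto simp: card_gt_0_iff)
  have fin: "finite E" using finite_subset[OF E finite_all_edges[OF V]] .
  have fin_N: "finite (neighbors V E w)" for w using V by (simp add: neighbors_def)
  have "(\<Sum>w\<in>V. real (degree V E w)) = (\<Sum>e\<in>E. \<Sum>w\<in>e. 1)"
    using sum_weighted_degrees[OF V E, of "\<lambda>_. 1"] by simp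
  also have "\<dots> = (\<Sum>e\<in>E. 2)" using E by (intro sum.cong) (auto simp: all_edges_def)
  finally have handshake: "(\<Sum>w\<in>V. real (degree V E w)) = 2 * card E" by simp
  have "groupie_excess V E v =
     (\<Sum>w\<in>V. of_bool ({v, w} \<in> E) * real (degree V E w)) / degree V E v - (\<Sum>w\<in>V. real (degree V E w)) / card V"
    by (simp add: groupie_excess_def groupie_weight_def algebra_simps sum_subtractf sum_divide_distrib)
  also have "\<dots> = neighbor_degree_sum V E v / degree V E v - 2 * card E / card V"
    by (simp only: sum_neighbors[OF V] handshake neighbor_degree_sum_def of_nat_sum)
  finally have excess: "groupie_excess V E v = neighbor_degree_sum V E v / degree V E v - 2 * card E / card V" .
  show ?thesis
  proof (cases "degree V E v = 0")
    case True
    have "(\<forall>u\<in>V. degree V E u = 0) \<longleftrightarrow> (\<Sum>w\<in>V. real (degree V E w)) = 0"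
      using V by (subst sum_nonneg_eq_0_iff) auto
    also have "\<dots> \<longleftrightarrow> card E = 0" by (simp add: handshake)
    also have "\<dots> \<longleftrightarrow> 0 \<le> groupie_excess V E v"
      using True card_V fin by (auto simp: excess divide_le_0_iff)
    finally show ?thesis using True by (simp add: groupie_def)
  qed (simp add: groupie_def excess)
qed

section \<open>Conditioning on the edges at two vertices\<close>

text \<open>The vertex weights of \<open>\<sigma> X\<^sub>u + \<tau> X\<^sub>v\<close>. Treating all
  such combinations at once gives the joint characteristic function of the two excesses.\<close>

definition pair_weight :: "'a set \<Rightarrow> 'a set set \<Rightarrow> 'a \<Rightarrow> 'a \<Rightarrow> real \<Rightarrow> real \<Rightarrow> 'a \<Rightarrow> real" where
  "pair_weight V E u v \<sigma> \<tau> w = \<sigma> * groupie_weight V E u w + \<tau> * groupie_weight V E v w"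

definition common_neighbors :: "'a set \<Rightarrow> 'a set set \<Rightarrow> 'a \<Rightarrow> 'a \<Rightarrow> nat" where
  "common_neighbors V E u v = card (neighbors V E u \<inter> neighbors V E v)"

text \<open>The edges at \<open>u\<close> or \<open>v\<close> are summed explicitly by inclusion and
  exclusion; the others are centred at \<open>p\<close>. The centring costs \<open>p\<close> times
  the total weight of all pairs inside \<open>V - {u, v}\<close>: there the vertex weights sum to
  \<open>- (\<alpha> u + \<alpha> v)\<close>, and each vertex lies in \<open>card V - 3\<close>
  pairs.\<close>

lemma sum_weighted_degrees_split:
  fixes \<alpha> :: "'a \<Rightarrow> real"
  assumes V: "finite V" and E: "E \<subseteq> all_edges V" and uv: "u \<in> V" "v \<in> V" "u \<noteq> v"
    and zero: "(\<Sum>w\<in>V. \<alpha> w) = 0"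
  shows "(\<Sum>w\<in>V. \<alpha> w * degree V E w) =
      degree V E u * \<alpha> u + (\<Sum>w\<in>neighbors V E u. \<alpha> w) + degree V E v * \<alpha> v + (\<Sum>w\<in>neighbors V E v. \<alpha> w)
      - of_bool ({u, v} \<in> E) * (\<alpha> u + \<alpha> v) - p * (real (card V) - 3) * (\<alpha> u + \<alpha> v)
      + (\<Sum>e\<in>all_edges (V - {u, v}). (\<Sum>w\<in>e. \<alpha> w) * (of_bool (e \<in> E) - p))"
proof -
  let ?f = "\<lambda>e. \<Sum>w\<in>e. \<alpha> w"
  let ?T = "all_edges (V - {u, v})"
  have finE: "finite E" using finite_subset[OF E finite_all_edges[OF V]] .
  have finT: "finite ?T" using V by (simp add: finite_all_edges)
  have incident: "(\<Sum>e | e \<in> E \<and> x \<in> e. ?f e) = degree V E x * \<alpha> x + (\<Sum>w\<in>neighbors V E x. \<alpha> w)" if "x \<in> V" for x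
  proof -
    have "(\<Sum>e | e \<in> E \<and> x \<in> e. ?f e) = (\<Sum>w\<in>neighbors V E x. ?f {x, w})"
      by (rule sum_over_incident_edges[OF V E that])
    also have "\<dots> = (\<Sum>w\<in>neighbors V E x. \<alpha> x + \<alpha> w)"
      using E by (intro sum.cong) (auto simp: neighbors_def insert_in_all_edges_iff dest!: subsetD)
    finally show ?thesis by (simp add: sum.distrib degree_def)
  qed
  \<comment> \<open>Since edges have two elements, only \<open>{u, v}\<close> can meet both
    vertices; it is counted twice when the sums at \<open>u\<close> and at \<open>v\<close> are
    added.\<close>
  have both: "{e \<in> E. u \<in> e} \<inter> {e \<in> E. v \<in> e} = (if {u, v} \<in> E then {{u, v}} else {})"
  proof -
    have "e = {u, v}" if "e \<in> E" "u \<in> e" "v \<in> e" for e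
    proof -
      have "card e = 2" using that E by (auto simp: all_edges_def)
      moreover from this have "finite e" by (simp add: card_ge_0_finite)
      ultimately show ?thesis using card_subset_eq[of e "{u, v}"] that uv by simp
    qed
    then have "e \<in> E \<and> u \<in> e \<and> v \<in> e \<longleftrightarrow> {u, v} \<in> E \<and> e = {u, v}" for e
      by (metis insert_iff)
    then have "{e \<in> E. u \<in> e} \<inter> {e \<in> E. v \<in> e} = {e. {u, v} \<in> E \<and> e = {u, v}}"
      by (simp add: Int_def conj_ac)
    then show ?thesis by simp
  qed
  have "(\<Sum>e | e \<in> E \<and> u \<in> e. ?f e) + (\<Sum>e | e \<in> E \<and> v \<in> e. ?f e)
      = (\<Sum>e\<in>{e \<in> E. u \<in> e} \<union> {e \<in> E. v \<in> e}. ?f e) + of_bool ({u, v} \<in> E) * (\<alpha> u + \<alpha> v)"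
    using sum.union_inter[of "{e \<in> E. u \<in> e}" "{e \<in> E. v \<in> e}" ?f] finE uv both
    by (cases "{u, v} \<in> E") simp_all
  moreover have "(\<Sum>e\<in>E. ?f e) = (\<Sum>e\<in>{e \<in> E. u \<in> e} \<union> {e \<in> E. v \<in> e}. ?f e) + (\<Sum>e\<in>?T \<inter> E. ?f e)"
    using E finE by (subst sum.union_disjoint[symmetric])
      (auto simp: all_edges_def intro!: sum.cong)
  moreover have "(\<Sum>e\<in>?T. ?f e * (of_bool (e \<in> E) - p)) = (\<Sum>e\<in>?T \<inter> E. ?f e) - p * (\<Sum>e\<in>?T. ?f e)"
  proof -
    have "?f e * (of_bool (e \<in> E) - p) = (if e \<in> E then ?f e else 0) - p * ?f e" for e
      by (simp add: algebra_simps)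
    then show ?thesis
      by (simp only: sum_subtractf sum.inter_restrict[OF finT] sum_distrib_left[of p ?f ?T])
  qed
  moreover have "(\<Sum>e\<in>?T. ?f e) = - (real (card V) - 3) * (\<alpha> u + \<alpha> v)"
  proof -
    have "{u, v} \<subseteq> V" using uv by simp
    then have card_sum: "real (card (V - {u, v})) = real (card V) - 2" "(\<Sum>w\<in>V - {u, v}. \<alpha> w) = - (\<alpha> u + \<alpha> v)"
      using V uv zero card_mono[OF V, of "{u, v}"] by (simp_all add: card_Diff_subset of_nat_diff sum_diff)
    have "finite (V - {u, v})" using V by simp
    from sum_edge_weights[OF this, of \<alpha>] show ?thesis
      unfolding card_sum by (simp add: algebra_simps)
  qed
  ultimately show ?thesis
    by (simp add: sum_weighted_degrees[OF V E] incident uv algebra_simps)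
qed

text \<open>This is \<open>sum_edge_weights_squared\<close> on the \<open>card V - 2\<close>
  remaining vertices, whose weights sum to \<open>- (\<alpha> u + \<alpha> v)\<close>.\<close>

lemma sum_remaining_edge_weights_squared:
  fixes \<alpha> :: "'a \<Rightarrow> real"
  assumes V: "finite V" and uv: "u \<in> V" "v \<in> V" "u \<noteq> v" and zero: "(\<Sum>w\<in>V. \<alpha> w) = 0"
  shows "(\<Sum>e\<in>all_edges (V - {u, v}). (\<Sum>w\<in>e. \<alpha> w)\<^sup>2) =
     (real (card V) - 4) * ((\<Sum>w\<in>V. (\<alpha> w)\<^sup>2) - (\<alpha> u)\<^sup>2 - (\<alpha> v)\<^sup>2) + (\<alpha> u + \<alpha> v)\<^sup>2"
proof -
  have sub: "{u, v} \<subseteq> V" using uv by simp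
  have 1: "real (card (V - {u, v})) = real (card V) - 2"
    using V uv sub card_mono[OF V sub] by (simp add: card_Diff_subset of_nat_diff)
  have 2: "(\<Sum>w\<in>V - {u, v}. f w) = (\<Sum>w\<in>V. f w) - f u - f v" for f :: "'a \<Rightarrow> real"
    using V uv sub by (simp add: sum_diff)
  have "finite (V - {u, v})" using V by simp
  from sum_edge_weights_squared[OF this, of \<alpha>] show ?thesis
    unfolding 1 2 zero by (simp add: power2_eq_square algebra_simps)
qed

section \<open>Sums of the pair weights in terms of degrees and common neighbours\<close>

context
  fixes V :: "'a set" and E :: "'a set set" and u v :: 'a
  assumes V: "finite V" and E: "E \<subseteq> all_edges V" and uv: "u \<in> V" "v \<in> V" "u \<noteq> v"
    and pos: "0 < degree V E u" "0 < degree V E v"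
begin

lemma sum_adj: "(\<Sum>w\<in>V. of_bool ({x, w} \<in> E)) = real (degree V E x)"
  using sum_neighbors[OF V, of x E "\<lambda>_. 1"] by (simp add: degree_def)

lemma sum_adj_adj: "(\<Sum>w\<in>V. of_bool ({u, w} \<in> E) * of_bool ({v, w} \<in> E)) = real (common_neighbors V E u v)"
proof -
  have "(\<Sum>w\<in>V. of_bool ({u, w} \<in> E) * of_bool ({v, w} \<in> E)) = (\<Sum>w\<in>neighbors V E u \<inter> neighbors V E v. 1 :: real)"
    by (rule sum.mono_neutral_cong_right) (use V in \<open>auto simp: neighbors_def\<close>)
  then show ?thesis by (simp add: common_neighbors_def)
qed

lemma card_V_pos: "0 < real (card V)"
  using V uv by (auto simp: card_gt_0_iff)

text \<open>Both parts of the weight sum to 1; for the adjacency part this uses that the degree is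
  positive.\<close>

lemma sum_groupie_weight:
  "(\<Sum>w\<in>V. groupie_weight V E u w) = 0" "(\<Sum>w\<in>V. groupie_weight V E v w) = 0"
  using pos card_V_pos by (simp_all add: groupie_weight_def sum_subtractf sum_adj flip: sum_divide_distrib)

lemma sum_pair_weight: "(\<Sum>w\<in>V. pair_weight V E u v \<sigma> \<tau> w) = 0"
  by (simp add: pair_weight_def sum.distrib sum_groupie_weight flip: sum_distrib_left)

lemma sum_pair_weight_neighbors:
  "(\<Sum>w\<in>neighbors V E u. pair_weight V E u v \<sigma> \<tau> w) = \<sigma> * (1 - real (degree V E u) / real (card V))
      + \<tau> * (real (common_neighbors V E u v) / real (degree V E v) - real (degree V E u) / real (card V))"
  "(\<Sum>w\<in>neighbors V E v. pair_weight V E u v \<sigma> \<tau> w) = \<sigma> * (real (common_neighbors V E u v) / real (degree V E u)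
      - real (degree V E v) / real (card V)) + \<tau> * (1 - real (degree V E v) / real (card V))"
proof -
  have expand: "of_bool ({x, w} \<in> E) * pair_weight V E u v \<sigma> \<tau> w =
      \<sigma> / real (degree V E u) * (of_bool ({x, w} \<in> E) * of_bool ({u, w} \<in> E))
          + \<tau> / real (degree V E v) * (of_bool ({x, w} \<in> E) * of_bool ({v, w} \<in> E))
      - (\<sigma> + \<tau>) / real (card V) * of_bool ({x, w} \<in> E)" for x w
    by (simp add: pair_weight_def groupie_weight_def algebra_simps add_divide_distrib)
  have idem: "(\<Sum>w\<in>V. of_bool ({x, w} \<in> E) * of_bool ({x, w} \<in> E)) = real (degree V E x)" for x
    using sum_adj[of x] by (simp add: of_bool_def if_distrib cong: if_cong)
  have comm: "(\<Sum>w\<in>V. of_bool ({v, w} \<in> E) * of_bool ({u, w} \<in> E)) = real (common_neighbors V E u v)"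
    using sum_adj_adj by (simp add: mult.commute)
  have "(\<Sum>w\<in>neighbors V E u. pair_weight V E u v \<sigma> \<tau> w) =
      \<sigma> / real (degree V E u) * real (degree V E u) + \<tau> / real (degree V E v) * real (common_neighbors V E u v)
          - (\<sigma> + \<tau>) / real (card V) * real (degree V E u)"
    unfolding sum_neighbors[OF V, symmetric] expand sum_subtractf sum.distrib sum_distrib_left[symmetric]
      sum_adj idem comm sum_adj_adj ..
  then show "(\<Sum>w\<in>neighbors V E u. pair_weight V E u v \<sigma> \<tau> w) = \<sigma> * (1 - real (degree V E u) / real (card V))
      + \<tau> * (real (common_neighbors V E u v) / real (degree V E v) - real (degree V E u) / real (card V))"
    using pos by (simp add: algebra_simps add_divide_distrib)
  have "(\<Sum>w\<in>neighbors V E v. pair_weight V E u v \<sigma> \<tau> w) =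
      \<sigma> / real (degree V E u) * real (common_neighbors V E u v) + \<tau> / real (degree V E v) * real (degree V E v)
          - (\<sigma> + \<tau>) / real (card V) * real (degree V E v)"
    unfolding sum_neighbors[OF V, symmetric] expand sum_subtractf sum.distrib sum_distrib_left[symmetric]
      sum_adj idem comm sum_adj_adj ..
  then show "(\<Sum>w\<in>neighbors V E v. pair_weight V E u v \<sigma> \<tau> w)
      = \<sigma> * (real (common_neighbors V E u v) / real (degree V E u) - real (degree V E v) / real (card V)) + \<tau> * (1
          - real (degree V E v) / real (card V))"
    using pos by (simp add: algebra_simps add_divide_distrib)
qed

text \<open>Expanding only one factor of the square into its two adjacency indicators and a constant
  reduces the sum to the two neighbourhood sums already computed. The constant contributes nothing
  because the weights sum to 0.\<close>

lemma sum_pair_weight_squared: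
  "(\<Sum>w\<in>V. (pair_weight V E u v \<sigma> \<tau> w)\<^sup>2) =
     \<sigma>\<^sup>2 * (1 / real (degree V E u) - 1 / real (card V))
         + 2 * \<sigma> * \<tau> * (real (common_neighbors V E u v) / (real (degree V E u) * real (degree V E v))
         - 1 / real (card V)) + \<tau>\<^sup>2 * (1 / real (degree V E v) - 1 / real (card V))"
proof -
  let ?a = "pair_weight V E u v \<sigma> \<tau>"
  have "(?a w)\<^sup>2 = \<sigma> / real (degree V E u) * (of_bool ({u, w} \<in> E) * ?a w)
      + \<tau> / real (degree V E v) * (of_bool ({v, w} \<in> E) * ?a w)
      - (\<sigma> + \<tau>) / real (card V) * ?a w" for w
  proof -
    have "?a w = \<sigma> / real (degree V E u) * of_bool ({u, w} \<in> E) + \<tau> / real (degree V E v) * of_bool ({v, w} \<in> E)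
        - (\<sigma> + \<tau>) / real (card V)"
      by (simp add: pair_weight_def groupie_weight_def algebra_simps add_divide_distrib)
    then have "?a w * ?a w = (\<sigma> / real (degree V E u) * of_bool ({u, w} \<in> E)
        + \<tau> / real (degree V E v) * of_bool ({v, w} \<in> E) - (\<sigma> + \<tau>) / real (card V)) * ?a w"
      by (rule arg_cong)
    then show ?thesis by (simp only: power2_eq_square distrib_right left_diff_distrib mult.assoc)
  qed
  then have "(\<Sum>w\<in>V. (?a w)\<^sup>2) = \<sigma> / real (degree V E u) * (\<sigma> * (1 - real (degree V E u) / real (card V))
      + \<tau> * (real (common_neighbors V E u v) / real (degree V E v) - real (degree V E u) / real (card V)))
      + \<tau> / real (degree V E v) * (\<sigma> * (real (common_neighbors V E u v) / real (degree V E u)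
          - real (degree V E v) / real (card V)) + \<tau> * (1 - real (degree V E v) / real (card V)))"
    by (simp only: sum_subtractf sum.distrib sum_distrib_left[symmetric] sum_neighbors[OF V]
        sum_pair_weight_neighbors sum_pair_weight)
  also have "\<dots> = \<sigma>\<^sup>2 * (1 / real (degree V E u) - 1 / real (card V))
      + 2 * \<sigma> * \<tau> * (real (common_neighbors V E u v) / (real (degree V E u) * real (degree V E v))
          - 1 / real (card V)) + \<tau>\<^sup>2 * (1 / real (degree V E v) - 1 / real (card V))"
    using pos card_V_pos by (simp add: field_simps power2_eq_square)
  finally show ?thesis .
qed

text \<open>There are no loops, so at \<open>u\<close> and at \<open>v\<close> only the adjacency to
  the other vertex can survive.\<close>

lemma pair_weight_endpoints:
  "pair_weight V E u v \<sigma> \<tau> u = - \<sigma> / real (card V) + \<tau> * (of_bool ({u, v} \<in> E) / real (degree V E v) - 1 / real (card V))"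
  "pair_weight V E u v \<sigma> \<tau> v = \<sigma> * (of_bool ({u, v} \<in> E) / real (degree V E u) - 1 / real (card V)) - \<tau> / real (card V)"
proof -
  have "{x} \<notin> E" for x using E insert_in_all_edges_iff[of x x V] by auto
  then show "pair_weight V E u v \<sigma> \<tau> u = - \<sigma> / real (card V) + \<tau> * (of_bool ({u, v} \<in> E) / real (degree V E v)
      - 1 / real (card V))"
    "pair_weight V E u v \<sigma> \<tau> v = \<sigma> * (of_bool ({u, v} \<in> E) / real (degree V E u) - 1 / real (card V)) - \<tau> / real (card V)"
    by (simp_all add: pair_weight_def groupie_weight_def insert_commute)
qed

lemma abs_pair_weight_le:
  "\<bar>pair_weight V E u v \<sigma> \<tau> w\<bar> \<le> \<bar>\<sigma>\<bar> * (1 / real (degree V E u) + 1 / real (card V))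
      + \<bar>\<tau>\<bar> * (1 / real (degree V E v) + 1 / real (card V))"
proof -
  have "\<bar>of_bool b / d - 1 / real (card V)\<bar> \<le> 1 / d + 1 / real (card V)" if "0 \<le> d" for d :: real and b
    using that card_V_pos by (cases b) (auto simp: abs_le_iff)
  then have "\<bar>groupie_weight V E u w\<bar> \<le> 1 / real (degree V E u) + 1 / real (card V)" "\<bar>groupie_weight V E v w\<bar>
      \<le> 1 / real (degree V E v) + 1 / real (card V)"
    by (simp_all add: groupie_weight_def)
  then show ?thesis
    unfolding pair_weight_def
    by (intro order_trans[OF abs_triangle_ineq] add_mono) (auto simp: abs_mult intro: mult_left_mono)
qed

end

section \<open>Limits of the conditional moments\<close>

text \<open>The arguments \<open>n, d, d', c, \<xi>\<close> stand for the number of vertices, the degrees of \<open>u\<close> and \<open>v\<close>, the number of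
  their common neighbours, and the indicator of the edge \<open>{u, v}\<close>. The first two functions are the values of
  \<open>pair_weight\<close> at \<open>u\<close> and \<open>v\<close>; the next two are the conditional mean of \<open>\<sigma> X\<^sub>u + \<tau> X\<^sub>v\<close> and the sum of
  the squared weights of the edges that avoid \<open>u\<close> and \<open>v\<close>.\<close>

definition first_weight :: "real \<Rightarrow> real \<Rightarrow> real \<Rightarrow> real \<Rightarrow> real \<Rightarrow> real" where
  "first_weight \<sigma> \<tau> n d' \<xi> = - \<sigma> / n + \<tau> * (\<xi> / d' - 1 / n)"

definition second_weight :: "real \<Rightarrow> real \<Rightarrow> real \<Rightarrow> real \<Rightarrow> real \<Rightarrow> real" where
  "second_weight \<sigma> \<tau> n d \<xi> = \<sigma> * (\<xi> / d - 1 / n) - \<tau> / n"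

definition cond_mean :: "real \<Rightarrow> real \<Rightarrow> real \<Rightarrow> real \<Rightarrow> real \<Rightarrow> real \<Rightarrow> real \<Rightarrow> real \<Rightarrow> real" where
  "cond_mean p \<sigma> \<tau> n d d' c \<xi> =
     d * first_weight \<sigma> \<tau> n d' \<xi> + (\<sigma> * (1 - d / n) + \<tau> * (c / d' - d / n))
     + d' * second_weight \<sigma> \<tau> n d \<xi> + (\<sigma> * (c / d - d' / n) + \<tau> * (1 - d' / n))
     - \<xi> * (first_weight \<sigma> \<tau> n d' \<xi> + second_weight \<sigma> \<tau> n d \<xi>)
     - p * (n - 3) * (first_weight \<sigma> \<tau> n d' \<xi> + second_weight \<sigma> \<tau> n d \<xi>)"

definition cond_sq_norm :: "real \<Rightarrow> real \<Rightarrow> real \<Rightarrow> real \<Rightarrow> real \<Rightarrow> real \<Rightarrow> real \<Rightarrow> real" where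
  "cond_sq_norm \<sigma> \<tau> n d d' c \<xi> =
     (n - 4) * (\<sigma>\<^sup>2 * (1 / d - 1 / n) + 2 * \<sigma> * \<tau> * (c / (d * d') - 1 / n) + \<tau>\<^sup>2 * (1 / d' - 1 / n)
       - (first_weight \<sigma> \<tau> n d' \<xi>)\<^sup>2 - (second_weight \<sigma> \<tau> n d \<xi>)\<^sup>2)
     + (first_weight \<sigma> \<tau> n d' \<xi> + second_weight \<sigma> \<tau> n d \<xi>)\<^sup>2"

text \<open>The uniform bound of \<open>abs_pair_weight_le\<close>. Twice this bounds the weight of
  an edge.\<close>

definition weight_bound :: "real \<Rightarrow> real \<Rightarrow> real \<Rightarrow> real \<Rightarrow> real \<Rightarrow> real" where
  "weight_bound \<sigma> \<tau> n d d' = \<bar>\<sigma>\<bar> * (1 / d + 1 / n) + \<bar>\<tau>\<bar> * (1 / d' + 1 / n)"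

section \<open>The characteristic function conditional on the edges at two vertices\<close>

definition graph_of :: "'a set \<Rightarrow> ('a set \<Rightarrow> bool) \<Rightarrow> 'a set set" where
  "graph_of V X = {e \<in> all_edges V. X e}"

lemma graph_of_subset: "graph_of V X \<subseteq> all_edges V"
  by (auto simp: graph_of_def)

text \<open>\<open>G Y\<close> takes the edges at \<open>u\<close> or \<open>v\<close> from
  \<open>X\<close> and redraws all others from \<open>Y\<close>. The vertex weights then do not
  depend on \<open>Y\<close>, so the combined excess is \<open>cond_mean\<close> plus a weighted sum
  of independent centred Bernoulli variables, to which \<open>char_weighted_bernoulli\<close>
  applies. An edge carries the weights of two vertices, hence the bound \<open>1 / 2\<close> in
  \<open>small\<close>. The number \<open>b\<close> is a deterministic phase.\<close>

lemma cond_char_excess: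
  fixes V :: "'a set" and X :: "'a set \<Rightarrow> bool" and p b \<sigma> \<tau> :: real
  assumes V: "finite V" and uv: "u \<in> V" "v \<in> V" "u \<noteq> v" and p: "0 \<le> p" "p \<le> 1"
  defines "T \<equiv> all_edges (V - {u, v})" and "E \<equiv> graph_of V X"
  defines "N \<equiv> real (card V)" and "d \<equiv> real (degree V E u)" and "d' \<equiv> real (degree V E v)"
    and "c \<equiv> real (common_neighbors V E u v)" and "\<xi> \<equiv> of_bool ({u, v} \<in> E)"
  defines "G \<equiv> \<lambda>Y. graph_of V (\<lambda>e. if e \<in> all_edges V - T then X e else Y e)"
  assumes pos: "0 < d" "0 < d'" and small: "weight_bound \<sigma> \<tau> N d d' \<le> 1 / 2"
  shows "norm (measure_pmf.expectation (Pi_pmf T False (\<lambda>_. bernoulli_pmf p))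
        (\<lambda>Y. iexp (b + \<sigma> * groupie_excess V (G Y) u + \<tau> * groupie_excess V (G Y) v))
      - iexp (b + cond_mean p \<sigma> \<tau> N d d' c \<xi>) * exp (- (p * (1 - p) * cond_sq_norm \<sigma> \<tau> N d d' c \<xi>) / 2))
     \<le> 4 * weight_bound \<sigma> \<tau> N d d' * cond_sq_norm \<sigma> \<tau> N d d' c \<xi>"
proof -
  let ?a = "pair_weight V E u v \<sigma> \<tau>"
  let ?m = "cond_mean p \<sigma> \<tau> N d d' c \<xi>"
  let ?M = "Pi_pmf T False (\<lambda>_. bernoulli_pmf p)"
  have E: "E \<subseteq> all_edges V" unfolding E_def by (rule graph_of_subset)
  have G: "G Y \<subseteq> all_edges V" for Y unfolding G_def by (rule graph_of_subset)
  have deg: "0 < degree V E u" "0 < degree V E v" using pos by (simp_all add: d_def d'_def)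
  have finT: "finite T" unfolding T_def using V by (simp add: finite_all_edges)
  have adj: "{x, w} \<in> G Y \<longleftrightarrow> {x, w} \<in> E" if "x = u \<or> x = v" for x w Y
    using that by (auto simp: G_def E_def graph_of_def T_def insert_in_all_edges_iff)
  have nb: "neighbors V (G Y) x = neighbors V E x" if "x = u \<or> x = v" for x Y
    using adj[OF that] by (simp add: neighbors_def)
  have dg: "degree V (G Y) x = degree V E x" if "x = u \<or> x = v" for x Y
    using nb[OF that] by (simp add: degree_def)
  have gw: "groupie_weight V (G Y) x = groupie_weight V E x" if "x = u \<or> x = v" for x Y
    using adj[OF that] dg[OF that] by (simp add: groupie_weight_def fun_eq_iff)
  have T_edge: "e \<in> G Y \<longleftrightarrow> Y e" if "e \<in> T" for e Y
    using that by (auto simp: G_def graph_of_def T_def all_edges_def)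
  have a_u: "?a u = first_weight \<sigma> \<tau> N d' \<xi>" and a_v: "?a v = second_weight \<sigma> \<tau> N d \<xi>"
    using pair_weight_endpoints[OF V E uv deg, of \<sigma> \<tau>]
    by (simp_all add: first_weight_def second_weight_def N_def d_def d'_def \<xi>_def)
  have excess: "\<sigma> * groupie_excess V (G Y) u + \<tau> * groupie_excess V (G Y) v =
      ?m + (\<Sum>e\<in>T. (\<Sum>w\<in>e. ?a w) * (of_bool (Y e) - p))" for Y
  proof -
    have "\<sigma> * groupie_excess V (G Y) u + \<tau> * groupie_excess V (G Y) v = (\<Sum>w\<in>V. ?a w * degree V (G Y) w)"
      by (simp add: groupie_excess_def pair_weight_def gw sum_distrib_left sum.distrib[symmetric] algebra_simps)
    also have "\<dots> = ?m + (\<Sum>e\<in>T. (\<Sum>w\<in>e. ?a w) * (of_bool (e \<in> G Y) - p))"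
      unfolding sum_weighted_degrees_split[OF V G uv sum_pair_weight[OF V E uv deg], of _ _ _ p]
      by (simp add: nb dg adj a_u a_v sum_pair_weight_neighbors[OF V E uv deg] cond_mean_def
          T_def[symmetric] N_def[symmetric] d_def[symmetric] d'_def[symmetric] c_def[symmetric] \<xi>_def[symmetric])
    also have "(\<Sum>e\<in>T. (\<Sum>w\<in>e. ?a w) * (of_bool (e \<in> G Y) - p)) = (\<Sum>e\<in>T. (\<Sum>w\<in>e. ?a w) * (of_bool (Y e) - p))"
      by (rule sum.cong) (simp_all add: T_edge)
    finally show ?thesis .
  qed
  have sq: "(\<Sum>e\<in>T. (\<Sum>w\<in>e. ?a w)\<^sup>2) = cond_sq_norm \<sigma> \<tau> N d d' c \<xi>"
    unfolding T_def sum_remaining_edge_weights_squared[OF V uv sum_pair_weight[OF V E uv deg]]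
      sum_pair_weight_squared[OF V E uv deg] a_u a_v
    by (simp add: cond_sq_norm_def N_def d_def d'_def c_def)
  have "\<bar>\<Sum>w\<in>e. ?a w\<bar> \<le> 2 * weight_bound \<sigma> \<tau> N d d'" if "e \<in> T" for e
  proof -
    have "card e = 2" using that by (simp add: T_def all_edges_def)
    then obtain x y where "e = {x, y}" "x \<noteq> y" by (meson card_2_iff)
    then have "\<bar>\<Sum>w\<in>e. ?a w\<bar> \<le> \<bar>?a x\<bar> + \<bar>?a y\<bar>" by simp
    also have "\<dots> \<le> weight_bound \<sigma> \<tau> N d d' + weight_bound \<sigma> \<tau> N d d'"
      using abs_pair_weight_le[OF V E uv deg, of \<sigma> \<tau>]
      by (intro add_mono) (simp_all add: weight_bound_def N_def d_def d'_def)
    finally show ?thesis by simp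
  qed
  then have "norm (measure_pmf.expectation ?M (\<lambda>Y. iexp (\<Sum>e\<in>T. (\<Sum>w\<in>e. ?a w) * (of_bool (Y e) - p)))
      - exp (- (p * (1 - p) * (\<Sum>e\<in>T. (\<Sum>w\<in>e. ?a w)\<^sup>2)) / 2))
    \<le> 2 * (2 * weight_bound \<sigma> \<tau> N d d') * (\<Sum>e\<in>T. (\<Sum>w\<in>e. ?a w)\<^sup>2)"
    by (rule char_weighted_bernoulli[OF finT p]) (use small in auto)
  moreover have "measure_pmf.expectation ?M
        (\<lambda>Y. iexp (b + \<sigma> * groupie_excess V (G Y) u + \<tau> * groupie_excess V (G Y) v))
      = iexp (b + ?m) * measure_pmf.expectation ?M (\<lambda>Y. iexp (\<Sum>e\<in>T. (\<Sum>w\<in>e. ?a w) * (of_bool (Y e) - p)))"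
  proof -
    have "iexp (b + \<sigma> * groupie_excess V (G Y) u + \<tau> * groupie_excess V (G Y) v)
        = iexp (b + ?m) * iexp (\<Sum>e\<in>T. (\<Sum>w\<in>e. ?a w) * (of_bool (Y e) - p))" for Y
      unfolding add.assoc excess by (simp only: of_real_add distrib_left exp_add mult.assoc)
    then show ?thesis by (simp only: integral_mult_right_zero)
  qed
  \<comment> \<open>The deterministic phase has modulus 1, so multiplying by it leaves the error
    unchanged.\<close>
  moreover have "norm (iexp (b + ?m) * z - iexp (b + ?m) * y) = norm (z - y)" for z y :: complex
    unfolding right_diff_distrib[symmetric] norm_mult norm_exp_i_times by simp
  ultimately show ?thesis by (simp only: sq)
qed

text \<open>For the edge indicator \<open>\<xi>\<close> as \<open>g\<close>: it need not converge,
  but it only multiplies terms that tend to 0.\<close>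

lemma tendsto_bounded_mult_zero:
  fixes f g :: "'a \<Rightarrow> real"
  assumes "(f \<longlongrightarrow> 0) F" "\<And>x. \<bar>g x\<bar> \<le> 1"
  shows "((\<lambda>x. g x * f x) \<longlongrightarrow> 0) F"
  by (rule Lim_null_comparison[OF always_eventually tendsto_rabs_zero[OF assms(1)]])
    (use assms(2) in \<open>auto simp: abs_mult intro: mult_left_le_one_le\<close>)

section \<open>Limits along a filter on which degrees and common neighbours concentrate\<close>

context
  fixes F :: "'a filter" and n d d' c \<xi> :: "'a \<Rightarrow> real" and p :: real
  assumes p: "0 < p" and n: "filterlim n at_top F"
    and d: "((\<lambda>x. d x / n x) \<longlongrightarrow> p) F" and d': "((\<lambda>x. d' x / n x) \<longlongrightarrow> p) F"
    and c: "((\<lambda>x. c x / n x) \<longlongrightarrow> p\<^sup>2) F" and \<xi>: "\<And>x. \<xi> x \<in> {0, 1}"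
begin

lemma inverse_n: "((\<lambda>x. 1 / n x) \<longlongrightarrow> 0) F"
  using n by (intro tendsto_divide_0[OF tendsto_const] filterlim_at_top_imp_at_infinity)

lemma eventually_pos: "\<forall>\<^sub>F x in F. 0 < n x \<and> 0 < d x \<and> 0 < d' x"
proof -
  have "\<forall>\<^sub>F x in F. 0 < n x" using n by (simp add: filterlim_at_top_dense)
  moreover have "\<forall>\<^sub>F x in F. 0 < d x / n x" "\<forall>\<^sub>F x in F. 0 < d' x / n x"
    using d d' p by (auto intro: order_tendstoD)
  ultimately show ?thesis by eventually_elim (auto simp: zero_less_divide_iff)
qed

lemma \<xi>_bound: "\<bar>\<xi> x\<bar> \<le> 1"
  using \<xi>[of x] by auto

lemma tendsto_weight_bound: "((\<lambda>x. weight_bound \<sigma> \<tau> (n x) (d x) (d' x)) \<longlongrightarrow> 0) F"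
proof -
  have "((\<lambda>x. \<bar>\<sigma>\<bar> * (1 / n x / (d x / n x) + 1 / n x) + \<bar>\<tau>\<bar> * (1 / n x / (d' x / n x) + 1 / n x))
      \<longlongrightarrow> \<bar>\<sigma>\<bar> * (0 / p + 0) + \<bar>\<tau>\<bar> * (0 / p + 0)) F"
    using p by (intro tendsto_intros d d' inverse_n) auto
  moreover have "\<forall>\<^sub>F x in F. \<bar>\<sigma>\<bar> * (1 / n x / (d x / n x) + 1 / n x) + \<bar>\<tau>\<bar> * (1 / n x / (d' x / n x) + 1 / n x)
      = weight_bound \<sigma> \<tau> (n x) (d x) (d' x)"
    using eventually_pos by eventually_elim (simp add: weight_bound_def)
  ultimately show ?thesis using Lim_transform_eventually by force
qed

text \<open>After division by \<open>n\<close>, the coefficients of \<open>\<sigma>\<close> and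
  \<open>\<tau>\<close> both tend to \<open>1 - 2 * p - 2 * p + p + 2 * p = 1 - p\<close>.\<close>

lemma tendsto_cond_mean:
  "((\<lambda>x. cond_mean p \<sigma> \<tau> (n x) (d x) (d' x) (c x) (\<xi> x)) \<longlongrightarrow> (\<sigma> + \<tau>) * (1 - p)) F"
proof -
  define h a a' k where "h x = 1 / n x" and "a x = d x / n x" and "a' x = d' x / n x" and "k x = c x / n x" for x
  note lims = inverse_n[folded h_def] d[folded a_def] d'[folded a'_def] c[folded k_def]
  define w w' where "w x = \<xi> x * (h x / a x)" and "w' x = \<xi> x * (h x / a' x)" for x
  note bounded = tendsto_bounded_mult_zero[OF _ \<xi>_bound]
  have w: "(w \<longlongrightarrow> 0) F"
    unfolding w_def[abs_def] using p by (intro bounded) (auto intro!: tendsto_eq_intros lims)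
  have w': "(w' \<longlongrightarrow> 0) F"
    unfolding w'_def[abs_def] using p by (intro bounded) (auto intro!: tendsto_eq_intros lims)
  \<comment> \<open>The edge \<open>{u, v}\<close> adds about \<open>d' / d\<close> through the
    degree of \<open>v\<close> and loses about \<open>p * n / d\<close> through the centring. Both
    tend to 1, so its effect disappears; the next fact is the same with \<open>u\<close> and
    \<open>v\<close> exchanged.\<close>
  have 1: "((\<lambda>x. \<xi> x * (a' x / a x - p * (1 - 3 * h x) / a x + 2 * h x - w x)) \<longlongrightarrow> 0) F"
    using p by (intro bounded) (auto intro!: tendsto_eq_intros lims w)
  have 2: "((\<lambda>x. \<xi> x * (a x / a' x - p * (1 - 3 * h x) / a' x + 2 * h x - w' x)) \<longlongrightarrow> 0) F"
    using p by (intro bounded) (auto intro!: tendsto_eq_intros lims w')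
  have "((\<lambda>x. \<sigma> * (1 - 2 * a x - 2 * a' x + k x / a x + 2 * p * (1 - 3 * h x)
        + \<xi> x * (a' x / a x - p * (1 - 3 * h x) / a x + 2 * h x - w x))
      + \<tau> * (1 - 2 * a x - 2 * a' x + k x / a' x + 2 * p * (1 - 3 * h x)
        + \<xi> x * (a x / a' x - p * (1 - 3 * h x) / a' x + 2 * h x - w' x)))
     \<longlongrightarrow> \<sigma> * (1 - 2 * p - 2 * p + p\<^sup>2 / p + 2 * p * (1 - 3 * 0) + 0)
       + \<tau> * (1 - 2 * p - 2 * p + p\<^sup>2 / p + 2 * p * (1 - 3 * 0) + 0)) F"
    using p by (intro tendsto_intros lims 1 2) auto
  moreover have "\<sigma> * (1 - 2 * p - 2 * p + p\<^sup>2 / p + 2 * p * (1 - 3 * 0) + 0)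
       + \<tau> * (1 - 2 * p - 2 * p + p\<^sup>2 / p + 2 * p * (1 - 3 * 0) + 0) = (\<sigma> + \<tau>) * (1 - p)"
    using p by (simp add: power2_eq_square algebra_simps)
  moreover have "\<forall>\<^sub>F x in F. \<sigma> * (1 - 2 * a x - 2 * a' x + k x / a x + 2 * p * (1 - 3 * h x)
        + \<xi> x * (a' x / a x - p * (1 - 3 * h x) / a x + 2 * h x - w x))
      + \<tau> * (1 - 2 * a x - 2 * a' x + k x / a' x + 2 * p * (1 - 3 * h x)
        + \<xi> x * (a x / a' x - p * (1 - 3 * h x) / a' x + 2 * h x - w' x))
      = cond_mean p \<sigma> \<tau> (n x) (d x) (d' x) (c x) (\<xi> x)"
    using eventually_pos
    by eventually_elim (simp add: cond_mean_def first_weight_def second_weight_def h_def a_def a'_def k_def w_def w'_def field_simps)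
  ultimately show ?thesis using Lim_transform_eventually by force
qed

text \<open>The mixed term has the factor \<open>c * n / (d * d') - 1\<close>, which tends to
  \<open>p^2 / (p * p) - 1 = 0\<close>. This is where the asymptotic independence of the two
  excesses comes from.\<close>

lemma tendsto_cond_sq_norm:
  "((\<lambda>x. cond_sq_norm \<sigma> \<tau> (n x) (d x) (d' x) (c x) (\<xi> x)) \<longlongrightarrow> (\<sigma>\<^sup>2 + \<tau>\<^sup>2) * (1 / p - 1)) F"
proof -
  define h a a' k where "h x = 1 / n x" and "a x = d x / n x" and "a' x = d' x / n x" and "k x = c x / n x" for x
  define j where "j x = \<xi> x * h x" for x
  have "(j \<longlongrightarrow> 0) F"
    using tendsto_bounded_mult_zero[OF inverse_n \<xi>_bound] by (simp add: j_def[abs_def] h_def)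
  note lims = inverse_n[folded h_def] d[folded a_def] d'[folded a'_def] c[folded k_def] this
  \<comment> \<open>\<open>B\<close> and \<open>B'\<close> are eventually \<open>n\<close> times the
    squares of the weights at \<open>u\<close> and \<open>v\<close>. As \<open>\<xi>\<close> is 0 or
    1 it equals its square, and with \<open>n * h = 1\<close> the factor \<open>n\<close> is
    absorbed, so that only null terms remain.\<close>
  define B B' where "B x = j x * (\<tau>\<^sup>2 / (a' x)\<^sup>2 - 2 * (\<sigma> + \<tau>) * \<tau> / a' x) + h x * (\<sigma> + \<tau>)\<^sup>2"
    and "B' x = j x * (\<sigma>\<^sup>2 / (a x)\<^sup>2 - 2 * (\<sigma> + \<tau>) * \<sigma> / a x) + h x * (\<sigma> + \<tau>)\<^sup>2" for x
  have B: "(B \<longlongrightarrow> 0) F" "(B' \<longlongrightarrow> 0) F"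
    unfolding B_def[abs_def] B'_def[abs_def] using p by (auto intro!: tendsto_eq_intros lims)
  have "((\<lambda>x. (1 - 4 * h x) * (\<sigma>\<^sup>2 * (1 / a x - 1) + 2 * \<sigma> * \<tau> * (k x / (a x * a' x) - 1) + \<tau>\<^sup>2 * (1 / a' x - 1)
      - B x - B' x)
      + (j x * \<tau> / a' x + j x * \<sigma> / a x - 2 * h x * (\<sigma> + \<tau>))\<^sup>2)
     \<longlongrightarrow> (1 - 4 * 0) * (\<sigma>\<^sup>2 * (1 / p - 1) + 2 * \<sigma> * \<tau> * (p\<^sup>2 / (p * p) - 1) + \<tau>\<^sup>2 * (1 / p - 1) - 0 - 0)
      + (0 * \<tau> / p + 0 * \<sigma> / p - 2 * 0 * (\<sigma> + \<tau>))\<^sup>2) F"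
    using p by (intro tendsto_intros lims B) auto
  moreover have "(1 - 4 * 0) * (\<sigma>\<^sup>2 * (1 / p - 1) + 2 * \<sigma> * \<tau> * (p\<^sup>2 / (p * p) - 1) + \<tau>\<^sup>2 * (1 / p - 1) - 0 - 0)
      + (0 * \<tau> / p + 0 * \<sigma> / p - 2 * 0 * (\<sigma> + \<tau>))\<^sup>2 = (\<sigma>\<^sup>2 + \<tau>\<^sup>2) * (1 / p - 1)"
    using p by (simp add: power2_eq_square algebra_simps)
  moreover have "\<forall>\<^sub>F x in F. (1 - 4 * h x) * (\<sigma>\<^sup>2 * (1 / a x - 1) + 2 * \<sigma> * \<tau> * (k x / (a x * a' x) - 1)
      + \<tau>\<^sup>2 * (1 / a' x - 1) - B x - B' x)
      + (j x * \<tau> / a' x + j x * \<sigma> / a x - 2 * h x * (\<sigma> + \<tau>))\<^sup>2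
      = cond_sq_norm \<sigma> \<tau> (n x) (d x) (d' x) (c x) (\<xi> x)"
    using eventually_pos
  proof eventually_elim
    fix x assume pos: "0 < n x \<and> 0 < d x \<and> 0 < d' x"
    have \<xi>2: "(\<xi> x)\<^sup>2 = \<xi> x" using \<xi>[of x] by auto
    have f: "first_weight \<sigma> \<tau> (n x) (d' x) (\<xi> x) = j x * \<tau> / a' x - h x * (\<sigma> + \<tau>)"
      and s: "second_weight \<sigma> \<tau> (n x) (d x) (\<xi> x) = j x * \<sigma> / a x - h x * (\<sigma> + \<tau>)"
      using pos by (simp_all add: first_weight_def second_weight_def j_def h_def a_def a'_def field_simps)
    have j2: "n x * (j x)\<^sup>2 = j x"
      using pos \<xi>2 by (simp add: j_def h_def power2_eq_square field_simps)
    have jh: "n x * h x = 1" using pos by (simp add: h_def)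
    have sq: "n x * (j x * w - h x * z)\<^sup>2 = j x * (w\<^sup>2 - 2 * z * w) + h x * z\<^sup>2" for w z
    proof -
      have "n x * (j x * w - h x * z)\<^sup>2 = (n x * (j x)\<^sup>2) * w\<^sup>2 - 2 * (n x * h x) * j x * w * z + (n x * h x) * h x * z\<^sup>2"
        by (simp add: power2_eq_square algebra_simps)
      then show ?thesis by (simp only: j2 jh) (simp add: algebra_simps)
    qed
    have BB: "B x = n x * (first_weight \<sigma> \<tau> (n x) (d' x) (\<xi> x))\<^sup>2"
        "B' x = n x * (second_weight \<sigma> \<tau> (n x) (d x) (\<xi> x))\<^sup>2"
      using sq[of "\<tau> / a' x" "\<sigma> + \<tau>"] sq[of "\<sigma> / a x" "\<sigma> + \<tau>"]
      by (simp_all add: f s B_def B'_def power_divide)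
    have fs: "j x * \<tau> / a' x + j x * \<sigma> / a x - 2 * h x * (\<sigma> + \<tau>) =
        first_weight \<sigma> \<tau> (n x) (d' x) (\<xi> x) + second_weight \<sigma> \<tau> (n x) (d x) (\<xi> x)"
      by (simp add: f s)
    have "1 / a x - 1 = n x * (1 / d x - 1 / n x)" "1 / a' x - 1 = n x * (1 / d' x - 1 / n x)"
      "k x / (a x * a' x) - 1 = n x * (c x / (d x * d' x) - 1 / n x)" "(1 - 4 * h x) = (n x - 4) / n x"
      using pos by (simp_all add: a_def a'_def k_def h_def field_simps)
    moreover have "(m - 4) / m * (A * (m * A1) + 2 * B * C * (m * A2) + D * (m * A3) - m * y - m * z) + q
        = (m - 4) * (A * A1 + 2 * B * C * A2 + D * A3 - y - z) + q" if "m \<noteq> 0"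
      for m A A1 B C A2 D A3 y z q :: real
      using that by (simp add: field_simps)
    ultimately show "(1 - 4 * h x) * (\<sigma>\<^sup>2 * (1 / a x - 1) + 2 * \<sigma> * \<tau> * (k x / (a x * a' x) - 1) + \<tau>\<^sup>2 * (1 / a' x
        - 1) - B x - B' x)
      + (j x * \<tau> / a' x + j x * \<sigma> / a x - 2 * h x * (\<sigma> + \<tau>))\<^sup>2
      = cond_sq_norm \<sigma> \<tau> (n x) (d x) (d' x) (c x) (\<xi> x)"
      unfolding fs BB cond_sq_norm_def using pos by simp
  qed
  ultimately show ?thesis using Lim_transform_eventually by force
qed

end

section \<open>Typical neighbourhoods\<close>

text \<open>The blocks are the single edges at \<open>u\<close>. The set \<open>A\<close> is left
  open because the lemma will be applied to the law of the edges meeting one of two given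
  vertices.\<close>

lemma chebyshev_degree:
  fixes p \<delta> :: real
  assumes A: "finite A" "\<And>w. w \<in> V \<Longrightarrow> w \<noteq> u \<Longrightarrow> {u, w} \<in> A" and V: "finite V" "u \<in> V"
    and p: "0 \<le> p" "p \<le> 1" and \<delta>: "0 < \<delta>"
  shows "measure_pmf.prob (Pi_pmf A False (\<lambda>_. bernoulli_pmf p))
      {X. \<delta> \<le> \<bar>real (degree V (graph_of V X) u) - (real (card V) - 1) * p\<bar>} \<le> real (card V) / \<delta>\<^sup>2"
proof -
  have nb: "neighbors V (graph_of V X) u = {w \<in> V - {u}. \<forall>e\<in>{{u, w}}. X e}" for X
    using V by (auto simp: neighbors_def graph_of_def insert_in_all_edges_iff)
  have "0 < card V" using V by (auto simp: card_gt_0_iff)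
  then have card: "real (card (V - {u})) = real (card V) - 1"
    using V by (simp add: of_nat_diff Suc_le_eq)
  have "measure_pmf.prob (Pi_pmf A False (\<lambda>_. bernoulli_pmf p))
      {X. \<delta> \<le> \<bar>real (card {w \<in> V - {u}. \<forall>e\<in>{{u, w}}. X e}) - real (card (V - {u})) * p ^ 1\<bar>} \<le> real (card (V
          - {u})) / \<delta>\<^sup>2"
    by (rule chebyshev_disjoint_cylinders) (use assms in \<open>auto simp: disjoint_family_on_def doubleton_eq_iff\<close>)
  also have "\<dots> \<le> real (card V) / \<delta>\<^sup>2"
    unfolding card by (intro divide_right_mono) auto
  finally show ?thesis unfolding nb[symmetric] card by (simp add: degree_def)
qed

text \<open>The block of \<open>w\<close> consists of its edges to \<open>u\<close> and
  \<open>v\<close>. Blocks of different \<open>w\<close> outside \<open>{u, v}\<close> are disjoint,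
  and each is full with probability \<open>p^2\<close>.\<close>

lemma chebyshev_common_neighbors:
  fixes p \<delta> :: real
  assumes A: "finite A" "\<And>x w. x \<in> {u, v} \<Longrightarrow> w \<in> V \<Longrightarrow> w \<noteq> x \<Longrightarrow> {x, w} \<in> A"
    and V: "finite V" "u \<in> V" "v \<in> V" "u \<noteq> v" and p: "0 \<le> p" "p \<le> 1" and \<delta>: "0 < \<delta>"
  shows "measure_pmf.prob (Pi_pmf A False (\<lambda>_. bernoulli_pmf p))
      {X. \<delta> \<le> \<bar>real (common_neighbors V (graph_of V X) u v) - (real (card V) - 2) * p\<^sup>2\<bar>} \<le> real (card V) / \<delta>\<^sup>2"
proof -
  have nb: "neighbors V (graph_of V X) u \<inter> neighbors V (graph_of V X) v
      = {w \<in> V - {u, v}. \<forall>e\<in>{{u, w}, {v, w}}. X e}" for X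
    using V by (auto simp: neighbors_def graph_of_def insert_in_all_edges_iff)
  have sub: "{u, v} \<subseteq> V" using V by simp
  have card: "real (card (V - {u, v})) = real (card V) - 2"
    using V sub card_mono[OF V(1) sub] by (simp add: card_Diff_subset of_nat_diff)
  have "measure_pmf.prob (Pi_pmf A False (\<lambda>_. bernoulli_pmf p))
      {X. \<delta> \<le> \<bar>real (card {w \<in> V - {u, v}. \<forall>e\<in>{{u, w}, {v, w}}. X e}) - real (card (V - {u, v})) * p ^ 2\<bar>}
    \<le> real (card (V - {u, v})) / \<delta>\<^sup>2"
    by (rule chebyshev_disjoint_cylinders)
      (use assms in \<open>auto simp: disjoint_family_on_def doubleton_eq_iff card_insert_if\<close>)
  also have "\<dots> \<le> real (card V) / \<delta>\<^sup>2"
    unfolding card by (intro divide_right_mono) auto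
  finally show ?thesis unfolding nb[symmetric] card by (simp add: common_neighbors_def)
qed

text \<open>On \<open>G n\<close> the integrand is uniformly close to \<open>L\<close>; off it the
  distance is at most 2, on a set of vanishing probability.\<close>

lemma expectation_tendsto_of_uniform:
  fixes h :: "nat \<Rightarrow> 'a \<Rightarrow> complex" and M :: "nat \<Rightarrow> 'a pmf"
  assumes unif: "\<And>e. 0 < e \<Longrightarrow> \<forall>\<^sub>F n in sequentially. \<forall>X\<in>G n. norm (h n X - L) < e"
    and h: "\<And>n X. norm (h n X) \<le> 1" and L: "norm L \<le> 1"
    and G: "(\<lambda>n. measure_pmf.prob (M n) (- G n)) \<longlonglongrightarrow> 0"
  shows "(\<lambda>n. measure_pmf.expectation (M n) (h n)) \<longlonglongrightarrow> L"
proof (rule tendstoI)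
  fix e :: real assume e: "0 < e"
  have "\<forall>\<^sub>F n in sequentially. measure_pmf.prob (M n) (- G n) < e / 4"
    using order_tendstoD(2)[OF G, of "e / 4"] e by simp
  with unif[of "e / 2"] e have "\<forall>\<^sub>F n in sequentially. (\<forall>X\<in>G n. norm (h n X
      - L) < e / 2) \<and> measure_pmf.prob (M n) (- G n) < e / 4"
    by (auto intro: eventually_conj)
  then show "\<forall>\<^sub>F n in sequentially. dist (measure_pmf.expectation (M n) (h n)) L < e"
  proof eventually_elim
    case (elim n)
    have int: "integrable (measure_pmf (M n)) (h n)"
      by (rule integrable_pmf_bounded[OF h])
    have "norm (measure_pmf.expectation (M n) (h n) - L) = norm (measure_pmf.expectation (M n) (\<lambda>X. h n X - L))"
      using int by simp
    also have "\<dots> \<le> measure_pmf.expectation (M n) (\<lambda>X. norm (h n X - L))"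
      by (rule integral_norm_bound)
    also have "\<dots> \<le> measure_pmf.expectation (M n) (\<lambda>X. e / 2 + 2 * indicator (- G n) X)"
    proof (rule integral_mono)
      fix X
      have "norm (h n X - L) \<le> 2" using norm_triangle_ineq4[of "h n X" L] h[of n X] L by linarith
      then show "norm (h n X - L) \<le> e / 2 + 2 * indicator (- G n) X"
        using elim e by (cases "X \<in> G n") (auto simp: less_imp_le)
      show "integrable (measure_pmf (M n)) (\<lambda>X. e / 2 + 2 * indicator (- G n) X)"
        by (rule integrable_pmf_bounded[of _ "e / 2 + 2"]) (use e in \<open>auto simp: indicator_def\<close>)
    qed (use int in auto)
    also have "\<dots> = e / 2 + 2 * measure_pmf.prob (M n) (- G n)"
    proof -
      have "integrable (measure_pmf (M n)) (indicator (- G n) :: 'a \<Rightarrow> real)"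
        by (rule integrable_pmf_bounded[of _ 1]) (simp add: indicator_def)
      then show ?thesis by (subst Bochner_Integration.integral_add) auto
    qed
    also have "\<dots> < e" using elim by linarith
    finally show ?case by (simp add: dist_norm)
  qed
qed

section \<open>Joint limit law for a pair of vertices that may change with \<open>n\<close>\<close>

context
  fixes p :: real and u v :: "nat \<Rightarrow> nat"
  assumes p: "0 < p" "p < 1"
    and uv: "\<And>n. 2 \<le> n \<Longrightarrow> u n < n \<and> v n < n \<and> u n \<noteq> v n"
begin

definition other_edges :: "nat \<Rightarrow> nat set set" where
  "other_edges n = all_edges ({..<n} - {u n, v n})"

definition endpoint_edges :: "nat \<Rightarrow> nat set set" where
  "endpoint_edges n = all_edges {..<n} - other_edges n"

text \<open>The exponent 3/4 lies between the order 1/2 of the fluctuations and 1: Chebyshev bounds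
  each exceptional probability by \<open>n powr (-1/2)\<close>, while the deviation divided by
  \<open>n\<close> is only \<open>n powr (-1/4)\<close>.\<close>

definition typical :: "nat \<Rightarrow> (nat set \<Rightarrow> bool) set" where
  "typical n = {X.
     \<bar>real (degree {..<n} (graph_of {..<n} X) (u n)) - (real n - 1) * p\<bar> < real n powr (3/4) \<and>
     \<bar>real (degree {..<n} (graph_of {..<n} X) (v n)) - (real n - 1) * p\<bar> < real n powr (3/4) \<and>
     \<bar>real (common_neighbors {..<n} (graph_of {..<n} X) (u n) (v n)) - (real n - 2) * p\<^sup>2\<bar> < real n powr (3/4)}"

lemma prob_not_typical:
  "(\<lambda>n. measure_pmf.prob (Pi_pmf (endpoint_edges n) False (\<lambda>_. bernoulli_pmf p)) (- typical n)) \<longlonglongrightarrow> 0"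
proof (rule tendsto_sandwich[OF _ _ tendsto_const])
  show "\<forall>\<^sub>F n in sequentially. measure_pmf.prob (Pi_pmf (endpoint_edges n) False (\<lambda>_. bernoulli_pmf p)) (- typical n)
      \<le> 3 * real n powr (-1/2)"
    using eventually_ge_at_top[of 2]
  proof eventually_elim
    fix n :: nat assume n: "2 \<le> n"
    let ?V = "{..<n}" and ?A = "endpoint_edges n" and ?\<delta> = "real n powr (3/4)"
    let ?P = "measure_pmf.prob (Pi_pmf ?A False (\<lambda>_. bernoulli_pmf p))"
    note uvn = uv[OF n]
    have \<delta>: "0 < ?\<delta>" using n by simp
    have fin: "finite ?A" by (simp add: endpoint_edges_def finite_all_edges)
    have edge: "{x, w} \<in> ?A" if "x \<in> {u n, v n}" "w \<in> ?V" "w \<noteq> x" for x w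
      using that uvn by (auto simp: endpoint_edges_def other_edges_def insert_in_all_edges_iff)
    define B1 B2 B3 where
      "B1 = {X. ?\<delta> \<le> \<bar>real (degree ?V (graph_of ?V X) (u n)) - (real (card ?V) - 1) * p\<bar>}" and
      "B2 = {X. ?\<delta> \<le> \<bar>real (degree ?V (graph_of ?V X) (v n)) - (real (card ?V) - 1) * p\<bar>}" and
      "B3 = {X. ?\<delta> \<le> \<bar>real (common_neighbors ?V (graph_of ?V X) (u n) (v n)) - (real (card ?V) - 2) * p\<^sup>2\<bar>}"
    have "?P B1 \<le> real (card ?V) / ?\<delta>\<^sup>2" "?P B2 \<le> real (card ?V) / ?\<delta>\<^sup>2" "?P B3 \<le> real (card ?V) / ?\<delta>\<^sup>2"
      unfolding B1_def B2_def B3_def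
      by (rule chebyshev_degree chebyshev_common_neighbors; use fin edge uvn p \<delta> in simp)+
    moreover have "- typical n = B1 \<union> B2 \<union> B3"
      by (auto simp: typical_def B1_def B2_def B3_def)
    moreover have "?P (B1 \<union> B2 \<union> B3) \<le> ?P B1 + ?P B2 + ?P B3"
      using measure_Un_le[of B1 _ B2] measure_Un_le[of "B1 \<union> B2" _ B3]
      by (smt (verit) UNIV_I sets_measure_pmf)
    moreover have "real (card ?V) / ?\<delta>\<^sup>2 = real n powr (-1/2)"
    proof -
      have "?\<delta>\<^sup>2 = real n powr (3/2)" by (simp add: power2_eq_square flip: powr_add)
      moreover have "real n powr 1 / real n powr (3/2) = real n powr (1 - 3/2)" by (rule powr_diff[symmetric])
      ultimately show ?thesis using n by simp
    qed
    ultimately show "?P (- typical n) \<le> 3 * real n powr (-1/2)" by simp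
  qed
  show "(\<lambda>n. 3 * real n powr (-1/2)) \<longlonglongrightarrow> 0"
    by real_asymp
qed auto

text \<open>Convergence along this filter is convergence as \<open>n \<rightarrow> \<infinity>\<close>, uniformly over typical configurations.\<close>

definition typical_filter :: "(nat \<times> (nat set \<Rightarrow> bool)) filter" where
  "typical_filter = inf (filtercomap fst sequentially) (principal {(n, X). X \<in> typical n})"

lemma eventually_typical_filter:
  "eventually P typical_filter \<longleftrightarrow> (\<forall>\<^sub>F n in sequentially. \<forall>X\<in>typical n. P (n, X))"
  by (auto simp: typical_filter_def eventually_inf_principal eventually_filtercomap_at_top_linorder eventually_sequentially)

text \<open>Both the deviation and the shift \<open>m * l\<close> are of smaller order than
  \<open>n\<close>. The shift is there because degrees count among \<open>n - 1\<close> vertices and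
  common neighbours among \<open>n - 2\<close>.\<close>

lemma tendsto_typical:
  fixes f :: "nat \<Rightarrow> (nat set \<Rightarrow> bool) \<Rightarrow> real"
  assumes "\<And>n X. X \<in> typical n \<Longrightarrow> \<bar>f n X - (real n - m) * l\<bar> < real n powr (3/4)"
  shows "((\<lambda>z. f (fst z) (snd z) / real (fst z)) \<longlongrightarrow> l) typical_filter"
proof -
  have lim: "(\<lambda>n. real n powr (-1/4) + \<bar>m * l\<bar> / real n) \<longlonglongrightarrow> 0"
    by real_asymp
  show ?thesis
  proof (rule Lim_transform[OF tendsto_const], rule Lim_null_comparison)
    show "((\<lambda>z. real (fst z) powr (-1/4) + \<bar>m * l\<bar> / real (fst z)) \<longlongrightarrow> 0) typical_filter"
      unfolding typical_filter_def
      by (rule tendsto_mono[OF inf_le1]) (rule filterlim_compose[OF lim filterlim_filtercomap])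
    have bound: "norm (f n X / real n - l) \<le> real n powr (-1/4) + \<bar>m * l\<bar> / real n"
      if "X \<in> typical n" and n: "0 < n" for n X
    proof -
      have "\<bar>real n * l - f n X\<bar> \<le> real n powr (3/4) + \<bar>m * l\<bar>"
        using assms[OF that(1)] by (simp add: abs_real_def algebra_simps split: if_splits)
      then have "\<bar>real n * l - f n X\<bar> / real n \<le> (real n powr (3/4) + \<bar>m * l\<bar>) / real n"
        by (rule divide_right_mono) simp
      also have "\<dots> = real n powr (3/4) / real n powr 1 + \<bar>m * l\<bar> / real n"
        using n by (simp add: add_divide_distrib)
      also have "real n powr (3/4) / real n powr 1 = real n powr (-1/4)"
        by (subst powr_diff[symmetric]) simp
      also have "\<bar>real n * l - f n X\<bar> / real n = \<bar>l - f n X / real n\<bar>"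
      proof -
        have "l - f n X / real n = (real n * l - f n X) / real n" using n by (simp add: field_simps)
        then show ?thesis by simp
      qed
      finally show ?thesis by (simp add: abs_minus_commute)
    qed
    show "\<forall>\<^sub>F z in typical_filter. norm (f (fst z) (snd z) / real (fst z) - l) \<le> real (fst z) powr (-1/4)
        + \<bar>m * l\<bar> / real (fst z)"
      unfolding eventually_typical_filter using eventually_gt_at_top[of 0]
      by eventually_elim (use bound in auto)
  qed
qed

text \<open>The excess has limiting mean and standard deviation both equal to \<open>1 - p\<close>,
  so \<open>1 - X / (1 - p)\<close> is its standardisation with reversed sign. Given the edges at
  \<open>u n\<close> and \<open>v n\<close>, the conditional characteristic function converges
  uniformly over typical configurations, and the others have vanishing probability.\<close>

lemma joint_char_excess:
  "(\<lambda>n. measure_pmf.expectation (Pi_pmf (all_edges {..<n}) False (\<lambda>_. bernoulli_pmf p))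
      (\<lambda>X. iexp (s * (1 - groupie_excess {..<n} (graph_of {..<n} X) (u n) / (1 - p))
        + t * (1 - groupie_excess {..<n} (graph_of {..<n} X) (v n) / (1 - p)))))
    \<longlonglongrightarrow> complex_of_real (exp (- (s\<^sup>2 + t\<^sup>2) / 2))"
proof -
  \<comment> \<open>With these coefficients the exponent is
    \<open>s + t + \<sigma> X\<^sub>u + \<tau> X\<^sub>v\<close>, and the phase \<open>s + t\<close>
    cancels the limit of the conditional mean.\<close>
  define \<sigma> \<tau> where "\<sigma> = - s / (1 - p)" and "\<tau> = - t / (1 - p)"
  have scale: "\<sigma> * (1 - p) = - s" "\<tau> * (1 - p) = - t"
    using p by (simp_all add: \<sigma>_def \<tau>_def)
  define f where "f n X = iexp (s + t + \<sigma> * groupie_excess {..<n} (graph_of {..<n} X) (u n)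
        + \<tau> * groupie_excess {..<n} (graph_of {..<n} X) (v n))" for n X
  define h where "h n X = measure_pmf.expectation (Pi_pmf (other_edges n) False (\<lambda>_. bernoulli_pmf p))
      (\<lambda>Y. f n (\<lambda>e. if e \<in> endpoint_edges n then X e else Y e))" for n X
  let ?L = "complex_of_real (exp (- (s\<^sup>2 + t\<^sup>2) / 2))"
  let ?n = "\<lambda>z :: nat \<times> (nat set \<Rightarrow> bool). real (fst z)"
  let ?E = "\<lambda>z :: nat \<times> (nat set \<Rightarrow> bool). graph_of {..<fst z} (snd z)"
  define d where "d z = real (degree {..<fst z} (?E z) (u (fst z)))" for z
  define d' where "d' z = real (degree {..<fst z} (?E z) (v (fst z)))" for z
  define c where "c z = real (common_neighbors {..<fst z} (?E z) (u (fst z)) (v (fst z)))" for z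
  define \<xi> where "\<xi> z = (of_bool ({u (fst z), v (fst z)} \<in> ?E z) :: real)" for z
  have n_lim: "filterlim ?n at_top typical_filter"
    unfolding typical_filter_def
    by (rule filterlim_mono[OF filterlim_compose[OF filterlim_real_sequentially filterlim_filtercomap] order_refl inf_le1])
  have d_lim: "((\<lambda>z. d z / ?n z) \<longlongrightarrow> p) typical_filter"
    unfolding d_def by (rule tendsto_typical[where m = 1]) (simp add: typical_def)
  have d'_lim: "((\<lambda>z. d' z / ?n z) \<longlongrightarrow> p) typical_filter"
    unfolding d'_def by (rule tendsto_typical[where m = 1]) (simp add: typical_def)
  have c_lim: "((\<lambda>z. c z / ?n z) \<longlongrightarrow> p\<^sup>2) typical_filter"
    unfolding c_def by (rule tendsto_typical[where m = 2]) (simp add: typical_def)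
  have \<xi>01: "\<xi> z \<in> {0, 1}" for z by (simp add: \<xi>_def)
  note hyps = p(1) n_lim d_lim d'_lim c_lim \<xi>01
  define m where "m z = cond_mean p \<sigma> \<tau> (?n z) (d z) (d' z) (c z) (\<xi> z)" for z
  define q where "q z = cond_sq_norm \<sigma> \<tau> (?n z) (d z) (d' z) (c z) (\<xi> z)" for z
  define k where "k z = weight_bound \<sigma> \<tau> (?n z) (d z) (d' z)" for z
  have m_lim: "(m \<longlongrightarrow> (\<sigma> + \<tau>) * (1 - p)) typical_filter"
    unfolding m_def[abs_def] by (rule tendsto_cond_mean[OF hyps])
  have q_lim: "(q \<longlongrightarrow> (\<sigma>\<^sup>2 + \<tau>\<^sup>2) * (1 / p - 1)) typical_filter"
    unfolding q_def[abs_def] by (rule tendsto_cond_sq_norm[OF hyps])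
  have k_lim: "(k \<longlongrightarrow> 0) typical_filter"
    unfolding k_def[abs_def] by (rule tendsto_weight_bound[OF hyps])
  have "((\<lambda>z. iexp (s + t + m z) * exp (- (p * (1 - p) * q z) / 2)) \<longlongrightarrow>
      iexp (s + t + (\<sigma> + \<tau>) * (1 - p)) * exp (- (p * (1 - p) * ((\<sigma>\<^sup>2 + \<tau>\<^sup>2) * (1 / p - 1))) / 2)) typical_filter"
    by (intro tendsto_intros m_lim q_lim) auto
  also have "s + t + (\<sigma> + \<tau>) * (1 - p) = 0"
    unfolding distrib_right scale by simp
  \<comment> \<open>The limiting variance of one excess is
    \<open>p * (1 - p) * (1 / p - 1) = (1 - p)^2\<close>.\<close>
  also have "p * (1 - p) * ((\<sigma>\<^sup>2 + \<tau>\<^sup>2) * (1 / p - 1)) = (\<sigma> * (1 - p))\<^sup>2 + (\<tau> * (1 - p))\<^sup>2"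
    using p by (simp add: field_simps power2_eq_square)
  also have "\<dots> = s\<^sup>2 + t\<^sup>2"
    by (simp add: scale)
  finally have main: "((\<lambda>z. iexp (s + t + m z) * exp (- (p * (1 - p) * q z) / 2)) \<longlongrightarrow> ?L) typical_filter"
    by simp
  have err: "((\<lambda>z. 4 * k z * q z) \<longlongrightarrow> 0) typical_filter"
  proof -
    have "((\<lambda>z. 4 * k z * q z) \<longlongrightarrow> 4 * 0 * ((\<sigma>\<^sup>2 + \<tau>\<^sup>2) * (1 / p - 1))) typical_filter"
      by (intro tendsto_intros k_lim q_lim)
    then show ?thesis by simp
  qed
  have "\<forall>\<^sub>F z in typical_filter. 2 \<le> fst z"
    unfolding eventually_typical_filter using eventually_ge_at_top[of 2] by eventually_elim simp
  moreover have "\<forall>\<^sub>F z in typical_filter. k z < 1 / 2"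
    using k_lim by (rule order_tendstoD) simp
  ultimately have "\<forall>\<^sub>F z in typical_filter.
      norm (h (fst z) (snd z) - iexp (s + t + m z) * exp (- (p * (1 - p) * q z) / 2)) \<le> 4 * k z * q z"
    using eventually_pos[OF hyps]
  proof eventually_elim
    case (elim z)
    have *: "u (fst z) \<in> {..<fst z}" "v (fst z) \<in> {..<fst z}" "u (fst z) \<noteq> v (fst z)"
      using uv[of "fst z"] elim by auto
    have "0 \<le> p" "p \<le> 1" using p by auto
    from cond_char_excess[OF finite_lessThan * this, of "snd z" \<sigma> \<tau> "s + t"] elim
    show ?case
      unfolding h_def f_def m_def q_def k_def d_def d'_def c_def \<xi>_def other_edges_def endpoint_edges_def
      by simp
  qed
  note diff = Lim_null_comparison[OF this err]
  have h_lim: "((\<lambda>z. h (fst z) (snd z)) \<longlongrightarrow> ?L) typical_filter"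
    by (rule Lim_transform[OF main diff])
  have norm_f: "norm (f n X) \<le> 1" for n X by (simp only: f_def norm_exp_i_times)
  have norm_h: "norm (h n X) \<le> 1" for n X
  proof -
    let ?M = "Pi_pmf (other_edges n) False (\<lambda>_. bernoulli_pmf p)"
    have "norm (h n X) \<le> measure_pmf.expectation ?M (\<lambda>Y. norm (f n (\<lambda>e. if e \<in> endpoint_edges n then X e else Y e)))"
      unfolding h_def by (rule integral_norm_bound)
    also have "\<dots> \<le> measure_pmf.expectation ?M (\<lambda>Y. 1)"
      by (rule integral_mono) (use norm_f in \<open>auto intro!: integrable_pmf_bounded[of _ 1]\<close>)
    finally show ?thesis by simp
  qed
  have "(\<lambda>n. measure_pmf.expectation (Pi_pmf (endpoint_edges n) False (\<lambda>_. bernoulli_pmf p)) (h n)) \<longlonglongrightarrow> ?L"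
  proof (rule expectation_tendsto_of_uniform[OF _ norm_h _ prob_not_typical])
    fix e :: real assume "0 < e"
    from tendstoD[OF h_lim this] show "\<forall>\<^sub>F n in sequentially. \<forall>X\<in>typical n. norm (h n X - ?L) < e"
      by (simp add: eventually_typical_filter dist_norm)
  qed (simp del: of_real_exp add: sum_power2_ge_zero)
  \<comment> \<open>Averaging the conditional expectation over the edges at the two vertices
    recovers the expectation over the whole graph.\<close>
  moreover have "measure_pmf.expectation (Pi_pmf (endpoint_edges n) False (\<lambda>_. bernoulli_pmf p)) (h n)
      = measure_pmf.expectation (Pi_pmf (all_edges {..<n}) False (\<lambda>_. bernoulli_pmf p)) (f n)" for n
  proof -
    have "other_edges n \<subseteq> all_edges {..<n}" by (auto simp: other_edges_def all_edges_def)
    then have "all_edges {..<n} = endpoint_edges n \<union> other_edges n" "endpoint_edges n \<inter> other_edges n = {}"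
      by (auto simp: endpoint_edges_def)
    moreover have "finite (endpoint_edges n)" "finite (other_edges n)"
      by (auto simp: endpoint_edges_def other_edges_def finite_all_edges)
    moreover have "finite (set_pmf (bernoulli_pmf p))" by (rule finite_subset[OF subset_UNIV]) simp
    ultimately show ?thesis unfolding h_def by (simp add: expectation_Pi_pmf_union)
  qed
  ultimately have "(\<lambda>n. measure_pmf.expectation (Pi_pmf (all_edges {..<n}) False (\<lambda>_. bernoulli_pmf p)) (f n)) \<longlonglongrightarrow> ?L"
    by (simp only:)
  moreover have "f = (\<lambda>n X. iexp (s * (1 - groupie_excess {..<n} (graph_of {..<n} X) (u n) / (1 - p))
        + t * (1 - groupie_excess {..<n} (graph_of {..<n} X) (v n) / (1 - p))))"
  proof -
    have "s + t + \<sigma> * x + \<tau> * y = s * (1 - x / (1 - p)) + t * (1 - y / (1 - p))" for x y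
      by (simp add: \<sigma>_def \<tau>_def algebra_simps)
    then show ?thesis unfolding f_def by simp
  qed
  ultimately show ?thesis by (simp only:)
qed

text \<open>As \<open>1 - p\<close> is positive, the excess is nonnegative iff its reversed
  standardisation is at most 1. This is why the limit is \<open>Phi\<close> at 1, and its square for
  the pair.\<close>

lemma prob_groupie:
  "(\<lambda>n. measure_pmf.prob (random_graph n p) {E. groupie {..<n} E (u n)}) \<longlonglongrightarrow> Phi 1"
  "(\<lambda>n. measure_pmf.prob (random_graph n p) {E. groupie {..<n} E (u n) \<and> groupie {..<n} E (v n)}) \<longlonglongrightarrow> Phi 1 * Phi 1"
proof -
  let ?M = "\<lambda>n. Pi_pmf (all_edges {..<n}) False (\<lambda>_. bernoulli_pmf p)"
  let ?Y = "\<lambda>w n X. 1 - groupie_excess {..<n} (graph_of {..<n} X) (w n) / (1 - p)"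
  have M: "random_graph n p = map_pmf (graph_of {..<n}) (?M n)" for n
    by (simp add: random_graph_def graph_of_def[abs_def])
  have iff: "groupie {..<n} (graph_of {..<n} X) w \<longleftrightarrow> 1 - groupie_excess {..<n} (graph_of {..<n} X) w / (1 - p) \<le> 1"
    if "w < n" for n w :: nat and X
    using groupie_iff_excess[OF finite_lessThan graph_of_subset, of w n X] that p
    by (simp add: zero_le_divide_iff)
  note lims = levy_pair[of ?M "?Y u" "?Y v", OF joint_char_excess, of 1]
  show "(\<lambda>n. measure_pmf.prob (random_graph n p) {E. groupie {..<n} E (u n)}) \<longlonglongrightarrow> Phi 1"
  proof (rule Lim_transform_eventually[OF lims(1)])
    show "\<forall>\<^sub>F n in sequentially. measure_pmf.prob (?M n) {X. ?Y u n X \<le> 1} =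
        measure_pmf.prob (random_graph n p) {E. groupie {..<n} E (u n)}"
      using eventually_ge_at_top[of 2] by eventually_elim (use uv in \<open>simp add: M vimage_def iff\<close>)
  qed
  show "(\<lambda>n. measure_pmf.prob (random_graph n p) {E. groupie {..<n} E (u n) \<and> groupie {..<n} E (v n)}) \<longlonglongrightarrow> Phi 1 * Phi 1"
  proof (rule Lim_transform_eventually[OF lims(2)])
    show "\<forall>\<^sub>F n in sequentially. measure_pmf.prob (?M n) {X. ?Y u n X \<le> 1 \<and> ?Y v n X \<le> 1} =
        measure_pmf.prob (random_graph n p) {E. groupie {..<n} E (u n) \<and> groupie {..<n} E (v n)}"
      using eventually_ge_at_top[of 2] by eventually_elim (use uv in \<open>simp add: M vimage_def iff\<close>)
  qed
qed

end

section \<open>Second moment of the number of groupies\<close>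

theorem theorem1:
  fixes p \<epsilon> :: real
  assumes "0 < p" and "p < 1" and "\<epsilon> > 0"
  shows "(\<lambda>n. measure_pmf.prob (random_graph n p)
            {E. \<bar>real (num_groupies {..<n} E) / real n - Phi 1\<bar> > \<epsilon>}) \<longlonglongrightarrow> 0"
proof -
  let ?\<phi> = "Phi 1"
  let ?g = "\<lambda>(n :: nat) E w. groupie {..<n} E w"
  define P1 where "P1 n w = measure_pmf.prob (random_graph n p) {E. ?g n E w}" for n w
  define P2 where "P2 n w x = measure_pmf.prob (random_graph n p) {E. ?g n E w \<and> ?g n E x}" for n w x
  \<comment> \<open>Up to the absolute value, the mixed second moment of two groupie indicators
    centred at the limit \<open>Phi 1\<close>, not at their own means. So the deviation from
    \<open>Phi 1\<close> is controlled directly.\<close>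
  define D where "D n w x = \<bar>P2 n w x - ?\<phi> * P1 n w - ?\<phi> * P1 n x + ?\<phi> * ?\<phi>\<bar>" for n w x
  have \<phi>: "0 \<le> ?\<phi>" "?\<phi> \<le> 1"
    using real_distribution.cdf_bounded_prob[OF real_dist_normal_dist, of 1]
    by (auto simp: Phi_def cdf_def)
  text \<open>Choosing the pair that maximises the covariance makes the pairwise estimate uniform without
    any appeal to exchangeability.\<close>
  have "\<exists>w x. w < n \<and> x < n \<and> w \<noteq> x \<and> (\<forall>w' x'. w' < n \<and> x' < n \<and> w' \<noteq> x' \<longrightarrow> D n w' x' \<le> D n w x)"
    if n: "2 \<le> n" for n
  proof -
    let ?A = "{z \<in> {..<n} \<times> {..<n}. fst z \<noteq> snd z}"
    have "finite ?A" by simp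
    moreover have "(0, 1) \<in> ?A" using n by simp
    then have "?A \<noteq> {}" by blast
    ultimately obtain z where "z \<in> ?A" "\<forall>z'\<in>?A. D n (fst z') (snd z') \<le> D n (fst z) (snd z)"
      using Max_in[of "(\<lambda>z. D n (fst z) (snd z)) ` ?A"] Max_ge[of "(\<lambda>z. D n (fst z) (snd z)) ` ?A"]
      by (smt (verit) empty_is_image finite_imageI imageE imageI)
    then show ?thesis by (intro exI[of _ "fst z"] exI[of _ "snd z"]) auto
  qed
  then obtain u v where uv: "\<And>n. 2 \<le> n \<Longrightarrow> u n < n \<and> v n < n \<and> u n \<noteq> v n"
    and D_max: "\<And>n w x. 2 \<le> n \<Longrightarrow> w < n \<Longrightarrow> x < n \<Longrightarrow> w \<noteq> x \<Longrightarrow> D n w x \<le> D n (u n) (v n)"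
    by metis
  \<comment> \<open>The single-vertex limit in \<open>prob_groupie\<close> concerns the first vertex
    of the pair; exchanging the roles gives it for \<open>v\<close> as well.\<close>
  have vu: "v n < n \<and> u n < n \<and> v n \<noteq> u n" if "2 \<le> n" for n using uv[OF that] by auto
  have D_lim: "(\<lambda>n. D n (u n) (v n)) \<longlonglongrightarrow> 0"
  proof -
    have "(\<lambda>n. P1 n (u n)) \<longlonglongrightarrow> ?\<phi>" "(\<lambda>n. P1 n (v n)) \<longlonglongrightarrow> ?\<phi>" "(\<lambda>n. P2 n (u n) (v n)) \<longlonglongrightarrow> ?\<phi> * ?\<phi>"
      unfolding P1_def P2_def
      using prob_groupie[of p u v, OF assms(1,2) uv] prob_groupie(1)[of p v u, OF assms(1,2) vu] by auto
    then have "(\<lambda>n. D n (u n) (v n)) \<longlonglongrightarrow> \<bar>?\<phi> * ?\<phi> - ?\<phi> * ?\<phi> - ?\<phi> * ?\<phi> + ?\<phi> * ?\<phi>\<bar>"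
      unfolding D_def by (intro tendsto_intros)
    then show ?thesis by simp
  qed
  have bound: "measure_pmf.prob (random_graph n p) {E. \<bar>real (num_groupies {..<n} E) / real n - ?\<phi>\<bar> > \<epsilon>}
      \<le> (1 / real n + D n (u n) (v n)) / \<epsilon>\<^sup>2" if n: "2 \<le> n" for n
  proof -
    let ?M = "random_graph n p"
    let ?E = "measure_pmf.expectation ?M"
    let ?V = "{..<n}"
    have fin: "finite (set_pmf ?M)"
      unfolding random_graph_def set_map_pmf
      by (intro finite_imageI finite_set_Pi_pmf finite_all_edges finite_lessThan finite)
    have int [simp]: "integrable (measure_pmf ?M) f" for f :: "_ \<Rightarrow> real"
      by (rule integrable_measure_pmf_finite[OF fin])
    define Z :: "nat \<Rightarrow> nat set set \<Rightarrow> real" where "Z w E = indicator {E. ?g n E w} E" for w E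
    have EZ: "?E (Z w) = P1 n w" for w
      by (simp add: Z_def[abs_def] P1_def)
    have EZZ: "?E (\<lambda>E. Z w E * Z x E) = P2 n w x" for w x
    proof -
      have "?E (\<lambda>E. Z w E * Z x E) = ?E (indicator {E. ?g n E w \<and> ?g n E x})"
        by (rule Bochner_Integration.integral_cong) (auto simp: Z_def indicator_def)
      then show ?thesis by (simp add: P2_def)
    qed
    have num: "real (num_groupies ?V E) = (\<Sum>w\<in>?V. Z w E)" for E
      by (simp add: num_groupies_def Z_def indicator_def sum.If_cases Int_def)
    have EE: "?E (\<lambda>E. (Z w E - ?\<phi>) * (Z x E - ?\<phi>)) = P2 n w x - ?\<phi> * P1 n w - ?\<phi> * P1 n x + ?\<phi> * ?\<phi>" for w x
      by (simp add: left_diff_distrib right_diff_distrib EZ EZZ mult.commute)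
    have diag: "?E (\<lambda>E. (Z w E - ?\<phi>) * (Z w E - ?\<phi>)) \<le> 1" for w
    proof -
      have "?E (\<lambda>E. (Z w E - ?\<phi>) * (Z w E - ?\<phi>)) \<le> ?E (\<lambda>E. 1)"
      proof (rule integral_mono)
        fix E
        have "\<bar>Z w E - ?\<phi>\<bar> \<le> 1" using \<phi> by (auto simp: Z_def indicator_def)
        then show "(Z w E - ?\<phi>) * (Z w E - ?\<phi>) \<le> 1"
          using abs_square_le_1[of "Z w E - ?\<phi>"] by (simp add: power2_eq_square)
      qed auto
      then show ?thesis by simp
    qed
    have D_nonneg: "0 \<le> D n (u n) (v n)" by (simp add: D_def)
    have "?E (\<lambda>E. (real (num_groupies ?V E) / real n - ?\<phi>)\<^sup>2)
        = ?E (\<lambda>E. (\<Sum>w\<in>?V. \<Sum>x\<in>?V. (Z w E - ?\<phi>) * (Z x E - ?\<phi>)) / (real n)\<^sup>2)"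
    proof (rule Bochner_Integration.integral_cong)
      fix E
      have "real (num_groupies ?V E) / real n - ?\<phi> = (\<Sum>w\<in>?V. Z w E - ?\<phi>) / real n"
        using n by (simp add: num sum_subtractf field_simps)
      then show "(real (num_groupies ?V E) / real n - ?\<phi>)\<^sup>2
        = (\<Sum>w\<in>?V. \<Sum>x\<in>?V. (Z w E - ?\<phi>) * (Z x E - ?\<phi>)) / (real n)\<^sup>2"
        by (simp add: power_divide power2_eq_square sum_product)
    qed simp
    also have "\<dots> = (\<Sum>w\<in>?V. \<Sum>x\<in>?V. ?E (\<lambda>E. (Z w E - ?\<phi>) * (Z x E - ?\<phi>))) / (real n)\<^sup>2"
      by simp
    \<comment> \<open>The \<open>n\<close> diagonal terms are at most 1 each and the others at most
      the maximal \<open>D\<close>. As the latter is nonnegative it may be added on the diagonal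
      too, so division by \<open>n^2\<close> leaves \<open>1 / n\<close> plus that maximum.\<close>
    also have "\<dots> \<le> (\<Sum>w\<in>?V. \<Sum>x\<in>?V. (if w = x then 1 else 0) + D n (u n) (v n)) / (real n)\<^sup>2"
    proof (intro divide_right_mono sum_mono)
      fix w x assume "w \<in> ?V" "x \<in> ?V"
      then show "?E (\<lambda>E. (Z w E - ?\<phi>) * (Z x E - ?\<phi>)) \<le> (if w = x then 1 else 0) + D n (u n) (v n)"
        using diag[of w] D_nonneg D_max[OF n, of w x] abs_ge_self[of "P2 n w x - ?\<phi> * P1 n w - ?\<phi> * P1 n x + ?\<phi> * ?\<phi>"]
        by (cases "w = x") (auto simp: EE D_def)
    qed simp
    also have "\<dots> = 1 / real n + D n (u n) (v n)"
      using n by (simp add: sum.distrib field_simps power2_eq_square)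
    finally have second: "?E (\<lambda>E. (real (num_groupies ?V E) / real n - ?\<phi>)\<^sup>2) \<le> 1 / real n + D n (u n) (v n)" .
    have sq: "\<epsilon>\<^sup>2 \<le> x\<^sup>2" if "\<epsilon> < \<bar>x\<bar>" for x :: real
      using power_mono[of \<epsilon> "\<bar>x\<bar>" 2] that assms(3) by simp
    have "measure_pmf.prob ?M {E. \<bar>real (num_groupies ?V E) / real n - ?\<phi>\<bar> > \<epsilon>}
        \<le> measure_pmf.prob ?M {E \<in> space ?M. \<epsilon>\<^sup>2 \<le> (real (num_groupies ?V E) / real n - ?\<phi>)\<^sup>2}"
      by (intro measure_pmf.finite_measure_mono subsetI) (simp_all add: sq)
    also have "\<dots> \<le> ?E (\<lambda>E. (real (num_groupies ?V E) / real n - ?\<phi>)\<^sup>2) / \<epsilon>\<^sup>2"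
      using assms(3) by (intro integral_Markov_inequality_measure[where A = "{}"]) auto
    also have "\<dots> \<le> (1 / real n + D n (u n) (v n)) / \<epsilon>\<^sup>2"
      by (intro divide_right_mono second) simp
    finally show ?thesis .
  qed
  have lim: "(\<lambda>n. (1 / real n + D n (u n) (v n)) / \<epsilon>\<^sup>2) \<longlonglongrightarrow> 0"
  proof -
    have "(\<lambda>n. (1 / real n + D n (u n) (v n)) / \<epsilon>\<^sup>2) \<longlonglongrightarrow> (0 + 0) / \<epsilon>\<^sup>2"
      using assms(3) by (intro tendsto_intros lim_1_over_n D_lim) auto
    then show ?thesis by simp
  qed
  show ?thesis
  proof (rule tendsto_sandwich[OF _ _ tendsto_const lim])
    show "\<forall>\<^sub>F n in sequentially. measure_pmf.prob (random_graph n p)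
            {E. \<bar>real (num_groupies {..<n} E) / real n - Phi 1\<bar> > \<epsilon>} \<le> (1 / real n + D n (u n) (v n)) / \<epsilon>\<^sup>2"
      using eventually_ge_at_top[of 2] by eventually_elim (rule bound)
  qed auto
qed

end
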